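(* Let $\nu>0$ and $$\mathcal{A}^{2,\nu}(\mathbb{C}^2):=\left\{F\in\mathcal{F}^{2,\nu}(\mathbb{C}^2);\ \left(\frac{\partial}{\partial z}+i\frac{\partial}{\partial w}\right)F=0\right\}.$$ Then: (i) $\mathcal{A}^{2,\nu}(\mathbb{C}^2)$ is a closed subspace of $\mathcal{F}^{2,\nu}(\mathbb{C}^2)$. (ii) The functions $e_m^\nu(z,w):=(z+iw)^m$, $m=0,1,2,\dots$, form an orthogonal basis of the Hilbert space $\mathcal{A}^{2,\nu}(\mathbb{C}^2)$. (iii) $\mathcal{A}^{2,\nu}(\mathbb{C}^2)=\mathcal{G}^\nu(L^{2,\nu}(\mathbb{R},\mathbb{C}))$.
   Context: Let $\nu>0$. $L^{2,\nu}(\mathbb{R},\mathbb{C})$ is the Hilbert space of $\mathbb{C}$-valued functions on $\mathbb{R}$ that are square integrable with respect to $e^{-\nu x^2}dx$. The Bargmann-Fock space $\mathcal{F}^{2,\nu}(\mathbb{C}^d)$ is the Hilbert space of holomorphic functions on $\mathbb{C}^d$ that are square integrable with respect to $e^{-\nu|z|^2}d\lambda$, $d\lambda$ the Lebesgue measure, with the corresponding $L^2$ scalar product. The space $\mathcal{A}^{2,\nu}(\mathbb{C}^2)$ carries the scalar product induced from $\mathcal{F}^{2,\nu}(\mathbb{C}^2)$. An orthogonal basis of a Hilbert space is an orthogonal system of nonzero vectors whose linear span is dense. The one-dimensional Segal-Bargmann transform, a unitary isomorphism from $L^{2,\nu}(\mathbb{R},\mathbb{C})$ onto $\mathcal{F}^{2,\nu}(\mathbb{C})$,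 is $$\mathcal{B}^{1,\nu}f(z)=\left(\frac{\nu}{\pi}\right)^{\frac34}\int_{\mathbb{R}}f(x)\,e^{-\nu\left(x-\frac{z}{\sqrt2}\right)^2}dx,\qquad z\in\mathbb{C}.$$ The transform $\mathcal{G}^\nu$ is defined on $L^{2,\nu}(\mathbb{R},\mathbb{C})$, with values in $\mathcal{F}^{2,\nu}(\mathbb{C}^2)$, by $$\mathcal{G}^\nu f(z,w)=\left(\frac{\nu}{\pi}\right)^{\frac12}(\mathcal{B}^{1,\nu}f)\left(\frac{z+iw}{\sqrt2}\right).$$ *)

theory Defs
  imports "HOL-Analysis.Analysis" "HOL-Library.Function_Algebras"
begin

text \<open>
  Function spaces are sets of total complex-valued functions. In particular, an element of
  \<open>L\<^sup>2\<close> is a representing function, not a class modulo almost-everywhere equality. On the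
  Fock space, whose elements are continuous, each class has exactly one such representative.
\<close>

interpretation cfun: vector_space "\<lambda>(c::complex) (f::'a \<Rightarrow> complex) x. c * f x"
  by unfold_locales (auto simp: fun_eq_iff algebra_simps)

subsection \<open>Square integrable functions\<close>

definition l2_space :: "'a measure \<Rightarrow> ('a \<Rightarrow> complex) set" where
  "l2_space M = {f \<in> borel_measurable M. integrable M (\<lambda>x. (norm (f x))\<^sup>2)}"

definition l2_inner :: "'a measure \<Rightarrow> ('a \<Rightarrow> complex) \<Rightarrow> ('a \<Rightarrow> complex) \<Rightarrow> complex" where
  "l2_inner M f g = (\<integral>x. f x * cnj (g x) \<partial>M)"

definition l2_norm :: "'a measure \<Rightarrow> ('a \<Rightarrow> complex) \<Rightarrow> real" where
  "l2_norm M f = sqrt (Re (l2_inner M f f))"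

definition l2_dist :: "'a measure \<Rightarrow> ('a \<Rightarrow> complex) \<Rightarrow> ('a \<Rightarrow> complex) \<Rightarrow> real" where
  "l2_dist M f g = l2_norm M (f - g)"

text \<open>
  Norm topology on a set \<open>H\<close> of square integrable functions. It is meaningful if \<^const>\<open>l2_dist\<close>
  separates the points of \<open>H\<close>; see \<open>Metric_space_fock_space\<close> below.
\<close>

definition l2_topology :: "'a measure \<Rightarrow> ('a \<Rightarrow> complex) set \<Rightarrow> ('a \<Rightarrow> complex) topology" where
  "l2_topology M H = Metric_space.mtopology H (l2_dist M)"

definition closed_subspace ::
  "'a measure \<Rightarrow> ('a \<Rightarrow> complex) set \<Rightarrow> ('a \<Rightarrow> complex) set \<Rightarrow> bool" where
  "closed_subspace M H A \<longleftrightarrow> cfun.subspace A \<and> A \<subseteq> H \<and> closedin (l2_topology M H) A"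

definition orthogonal_basis ::
  "'a measure \<Rightarrow> ('a \<Rightarrow> complex) set \<Rightarrow> (nat \<Rightarrow> 'a \<Rightarrow> complex) \<Rightarrow> bool" where
  "orthogonal_basis M H e \<longleftrightarrow>
     (\<forall>m. e m \<in> H \<and> e m \<noteq> 0) \<and>
     (\<forall>m n. m \<noteq> n \<longrightarrow> l2_inner M (e m) (e n) = 0) \<and>
     l2_topology M H closure_of (cfun.span (range e)) = H"

subsection \<open>The Bargmann-Fock space\<close>

text \<open>
  The norm on \<^typ>\<open>complex \<times> complex\<close> is the Euclidean one, \<open>|(z, w)|\<^sup>2 = |z|\<^sup>2 + |w|\<^sup>2\<close>.
\<close>

definition gauss_measure :: "real \<Rightarrow> 'a::euclidean_space measure" where
  "gauss_measure \<nu> = density lborel (\<lambda>x. ennreal (exp (- \<nu> * (norm x)\<^sup>2)))"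

text \<open>Holomorphic on all of \<open>\<complex>\<^sup>2\<close>: the real total derivative exists everywhere and is complex linear.\<close>

definition holomorphic2 :: "(complex \<times> complex \<Rightarrow> complex) \<Rightarrow> bool" where
  "holomorphic2 F \<longleftrightarrow>
     (\<forall>p. \<exists>D. (F has_derivative D) (at p) \<and> (\<forall>c z w. D (c * z, c * w) = c * D (z, w)))"

definition fock_space :: "real \<Rightarrow> (complex \<times> complex \<Rightarrow> complex) set" where
  "fock_space \<nu> = {F \<in> l2_space (gauss_measure \<nu>). holomorphic2 F}"

text \<open>
  The operators \<open>\<partial>/\<partial>z\<close> and \<open>\<partial>/\<partial>w\<close> are only applied to holomorphic functions, where they
  are the complex partial derivatives.
\<close>

definition A_space :: "real \<Rightarrow> (complex \<times> complex \<Rightarrow> complex) set" where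
  "A_space \<nu> =
     {F \<in> fock_space \<nu>.
        \<forall>z w. deriv (\<lambda>\<zeta>. F (\<zeta>, w)) z + \<i> * deriv (\<lambda>\<omega>. F (z, \<omega>)) w = 0}"

definition e_fun :: "nat \<Rightarrow> complex \<times> complex \<Rightarrow> complex" where
  "e_fun m = (\<lambda>(z, w). (z + \<i> * w) ^ m)"

subsection \<open>The transforms\<close>

definition bargmann :: "real \<Rightarrow> (real \<Rightarrow> complex) \<Rightarrow> complex \<Rightarrow> complex" where
  "bargmann \<nu> f z =
     complex_of_real ((\<nu> / pi) powr (3/4)) *
     (\<integral>x. f x * exp (- complex_of_real \<nu> * (complex_of_real x - z / complex_of_real (sqrt 2))\<^sup>2) \<partial>lborel)"

definition G_transform :: "real \<Rightarrow> (real \<Rightarrow> complex) \<Rightarrow> complex \<times> complex \<Rightarrow> complex" where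
  "G_transform \<nu> f = (\<lambda>(z, w).
     complex_of_real ((\<nu> / pi) powr (1/2)) *
     bargmann \<nu> f ((z + \<i> * w) / complex_of_real (sqrt 2)))"

subsection \<open>The Fock space is a metric space\<close>

lemma l2_norm_eq: "l2_norm M f = sqrt (\<integral>x. (norm (f x))\<^sup>2 \<partial>M)"
proof -
  have "l2_inner M f f = (\<integral>x. complex_of_real ((norm (f x))\<^sup>2) \<partial>M)"
    unfolding l2_inner_def by (simp only: complex_norm_square)
  then show ?thesis
    by (simp only: l2_norm_def integral_complex_of_real Re_complex_of_real)
qed

lemma l2_space_diff:
  assumes f: "f \<in> l2_space M" and g: "g \<in> l2_space M"
  shows "f - g \<in> l2_space M"
proof -
  have [measurable]: "f \<in> borel_measurable M" "g \<in> borel_measurable M"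
    using f g by (auto simp: l2_space_def)
  have bound: "norm ((norm ((f - g) x))\<^sup>2) \<le> norm (2 * (norm (f x))\<^sup>2 + 2 * (norm (g x))\<^sup>2)" for x
  proof -
    have "(norm (f x - g x))\<^sup>2 \<le> (norm (f x) + norm (g x))\<^sup>2"
      by (intro power_mono norm_triangle_ineq4) auto
    also have "\<dots> \<le> 2 * (norm (f x))\<^sup>2 + 2 * (norm (g x))\<^sup>2"
      using zero_le_power2[of "norm (f x) - norm (g x)"] by (simp add: power2_eq_square algebra_simps)
    finally show ?thesis by simp
  qed
  have int: "integrable M (\<lambda>x. 2 * (norm (f x))\<^sup>2 + 2 * (norm (g x))\<^sup>2)"
    using f g by (auto simp: l2_space_def)
  have meas: "f - g \<in> borel_measurable M"
    unfolding fun_diff_def by measurable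
  then have meas2: "(\<lambda>x. (norm ((f - g) x))\<^sup>2) \<in> borel_measurable M"
    by (intro borel_measurable_power measurable_compose[OF _ borel_measurable_norm])
  have "integrable M (\<lambda>x. (norm ((f - g) x))\<^sup>2)"
    by (rule Bochner_Integration.integrable_bound[OF int meas2]) (rule AE_I2, rule bound)
  with meas show ?thesis by (simp only: l2_space_def mem_Collect_eq)
qed

lemma l2_norm_triangle:
  assumes f: "f \<in> l2_space M" and g: "g \<in> l2_space M" and h: "h \<in> l2_space M"
    and le: "\<And>x. norm (h x) \<le> norm (f x) + norm (g x)"
  shows "l2_norm M h \<le> l2_norm M f + l2_norm M g"
proof (rule field_le_epsilon)
  fix \<epsilon> :: real assume "\<epsilon> > 0"
  define s t where "s = l2_norm M f + \<epsilon>/2" and "t = l2_norm M g + \<epsilon>/2"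
  have nn: "0 \<le> l2_norm M f" "0 \<le> l2_norm M g" by (auto simp: l2_norm_eq)
  then have st: "s > 0" "t > 0" using \<open>\<epsilon> > 0\<close> by (auto simp: s_def t_def)
  let ?I = "\<lambda>f. \<integral>x. (norm (f x))\<^sup>2 \<partial>M"
  have bf: "?I f \<le> s\<^sup>2"
  proof -
    have "?I f = (l2_norm M f)\<^sup>2" by (simp add: l2_norm_eq)
    also have "\<dots> \<le> s\<^sup>2" using nn \<open>\<epsilon> > 0\<close> by (intro power_mono) (auto simp: s_def)
    finally show ?thesis .
  qed
  have bg: "?I g \<le> t\<^sup>2"
  proof -
    have "?I g = (l2_norm M g)\<^sup>2" by (simp add: l2_norm_eq)
    also have "\<dots> \<le> t\<^sup>2" using nn \<open>\<epsilon> > 0\<close> by (intro power_mono) (auto simp: t_def)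
    finally show ?thesis .
  qed
  have pw: "(norm (h x))\<^sup>2 \<le> (1 + t/s) * (norm (f x))\<^sup>2 + (1 + s/t) * (norm (g x))\<^sup>2" for x
  proof -
    define a b where "a = norm (f x)" and "b = norm (g x)"
    have "(norm (h x))\<^sup>2 \<le> (a + b)\<^sup>2" unfolding a_def b_def by (intro power_mono le) auto
    moreover have "(1 + t/s) * a\<^sup>2 + (1 + s/t) * b\<^sup>2 - (a + b)\<^sup>2 = (t * a - s * b)\<^sup>2 / (s * t)"
      using st by (simp add: field_simps power2_eq_square)
    moreover have "(t * a - s * b)\<^sup>2 / (s * t) \<ge> 0" using st by simp
    ultimately show ?thesis unfolding a_def b_def by linarith
  qed
  have "?I h \<le> (\<integral>x. (1 + t/s) * (norm (f x))\<^sup>2 + (1 + s/t) * (norm (g x))\<^sup>2 \<partial>M)"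
    using f g h by (intro integral_mono pw) (auto simp: l2_space_def)
  also have "\<dots> = (1 + t/s) * ?I f + (1 + s/t) * ?I g"
    using f g by (simp add: l2_space_def)
  also have "\<dots> \<le> (1 + t/s) * s\<^sup>2 + (1 + s/t) * t\<^sup>2"
    using st by (intro add_mono mult_left_mono bf bg) auto
  also have "\<dots> = (s + t)\<^sup>2" using st by (simp add: field_simps power2_eq_square)
  finally have "l2_norm M h \<le> s + t"
    using st unfolding l2_norm_eq by (intro real_le_lsqrt) auto
  then show "l2_norm M h \<le> l2_norm M f + l2_norm M g + \<epsilon>" by (simp add: s_def t_def)
qed

lemma continuous_l2_norm_zero:
  fixes f :: "'a::euclidean_space \<Rightarrow> complex"
  assumes f: "f \<in> l2_space (gauss_measure \<nu>)" and cont: "continuous_on UNIV f"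
    and zero: "l2_norm (gauss_measure \<nu>) f = 0"
  shows "f = 0"
proof -
  have "AE x in gauss_measure \<nu>. (norm (f x))\<^sup>2 = 0"
    using f zero by (subst integral_nonneg_eq_0_iff_AE[symmetric]) (auto simp: l2_space_def l2_norm_eq)
  then have "AE x in lborel. f x = 0"
    unfolding gauss_measure_def by (subst (asm) AE_density) auto
  then have "AE x in lebesgue. x \<in> {x. f x = 0}"
    by (intro AE_completion) auto
  moreover have "closed {x. f x = 0}"
    using continuous_closed_vimage[of "{0}" f] cont
    by (auto simp: vimage_def continuous_on_eq_continuous_at)
  ultimately have "x \<in> {x. f x = 0}" for x
    using mem_closed_if_AE_lebesgue by blast
  then show ?thesis by (auto simp: fun_eq_iff)
qed

lemma Metric_space_fock_space: "Metric_space (fock_space \<nu>) (l2_dist (gauss_measure \<nu>))"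
proof
  let ?M = "gauss_measure \<nu> :: (complex \<times> complex) measure"
  fix F G H :: "complex \<times> complex \<Rightarrow> complex"
  show "0 \<le> l2_dist ?M F G" by (simp add: l2_dist_def l2_norm_eq)
  show "l2_dist ?M F G = l2_dist ?M G F"
    by (simp add: l2_dist_def l2_norm_eq norm_minus_commute)
  assume F: "F \<in> fock_space \<nu>" and G: "G \<in> fock_space \<nu>"
  have cont: "continuous_on UNIV F" if "F \<in> fock_space \<nu>" for F
    using that unfolding fock_space_def holomorphic2_def
    by (auto simp: continuous_on_eq_continuous_at dest!: spec intro: has_derivative_continuous)
  show "l2_dist ?M F G = 0 \<longleftrightarrow> F = G"
  proof
    assume "l2_dist ?M F G = 0"
    moreover have "F - G \<in> l2_space ?M" using F G by (auto simp: fock_space_def intro: l2_space_diff)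
    moreover have "continuous_on UNIV (F - G)"
      using continuous_on_diff[OF cont[OF F] cont[OF G]] by (simp only: fun_diff_def)
    ultimately have "F - G = 0" unfolding l2_dist_def by (intro continuous_l2_norm_zero) auto
    then show "F = G" by simp
  qed (simp add: l2_dist_def l2_norm_eq)
  assume H: "H \<in> fock_space \<nu>"
  have "norm ((F - H) p) \<le> norm ((F - G) p) + norm ((G - H) p)" for p
    using norm_triangle_ineq[of "F p - G p" "G p - H p"] by simp
  then show "l2_dist ?M F H \<le> l2_dist ?M F G + l2_dist ?M G H"
    unfolding l2_dist_def using F G H
    by (intro l2_norm_triangle l2_space_diff) (auto simp: fock_space_def)
qed

end

theory Submission
  imports Defs "HOL-Complex_Analysis.Complex_Analysis" "HOL-Probability.Distributions"
    "HOL-Real_Asymp.Real_Asymp"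
begin

text \<open>
  A holomorphic \<open>F\<close> annihilated by \<open>\<partial>/\<partial>z + \<i> \<partial>/\<partial>w\<close> is constant along the direction \<open>(-\<i>, 1)\<close>, so it is
  \<open>g (z + \<i> w)\<close> for an entire function \<open>g\<close> with Taylor coefficients \<open>a\<^sub>n\<close>. The Gaussian measure is invariant
  under \<open>(z, w) \<mapsto> (e\<^sup>i\<^sup>\<theta> z, e\<^sup>i\<^sup>\<theta> w)\<close>, so the functions \<open>e\<^sub>n\<close> are orthogonal on every ball, where the Taylor series
  converges uniformly; exhausting the space by balls gives \<open>\<parallel>F\<parallel>\<^sup>2 = \<Sum> |a\<^sub>n|\<^sup>2 \<parallel>e\<^sub>n\<parallel>\<^sup>2\<close>, also when both sides
  are infinite. On the real line, the Bargmann kernel is the generating function of Hermite polynomials, so the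
  coefficients of \<open>G f\<close> are multiples of the inner products of \<open>f\<close> with them. The norms match, hence
  Bessel's inequality shows that \<open>G\<close> maps into \<open>A\<close>, and the Riesz-Fischer theorem that it is onto.
\<close>

subsection \<open>Square integrable functions\<close>

text \<open>Elements of the spaces are functions and not classes, so
  \<open>F = G_transform \<nu> f\<close> has to hold at every point. Both sides are therefore
  compared through the Taylor coefficients of entire functions of one variable. The same
  coefficients decide membership in \<open>A_space\<close>: Parseval is an identity in
  \<open>ennreal\<close>, so convergence of the coefficient series amounts to square integrability.
  The norms of \<open>e_fun n\<close> come from Parseval itself, applied to
  \<open>exp (c * (z + \<i> * w))\<close>, whose squared norm is an explicit Gaussian integral. The
  constants of the transform fit together as follows. The square of
  \<open>(\<nu> / pi) powr (1/2) * (\<nu> / pi) powr (3/4)\<close> cancels the product of the total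
  masses of the two Gaussian measures, \<open>(pi / \<nu>)^2\<close> on \<complex>^2 and
  \<open>sqrt (pi / \<nu>)\<close> on the line. Dividing the argument by \<open>sqrt 2\<close> turns
  the factor \<open>(2 / \<nu>)^n * n!\<close> in the norm of \<open>e_fun n\<close> into
  \<open>n! / \<nu>^n\<close>, the reciprocal of the corresponding factor for the Hermite
  polynomials.\<close>

lemma l2_space_cmult: "f \<in> l2_space M \<Longrightarrow> (\<lambda>x. c * f x) \<in> l2_space M"
  by (auto simp: l2_space_def norm_mult power_mult_distrib)

lemma l2_space_add:
  assumes "f \<in> l2_space M" "g \<in> l2_space M"
  shows "f + g \<in> l2_space M"
  using l2_space_diff[OF assms(1) l2_space_cmult[OF assms(2), of "-1"]]
  by (simp add: fun_diff_def plus_fun_def)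

lemma l2_space_integrable_mult:
  assumes f: "f \<in> l2_space M" and g: "g \<in> l2_space M"
  shows "integrable M (\<lambda>x. f x * g x)"
proof (rule Bochner_Integration.integrable_bound)
  show "integrable M (\<lambda>x. (norm (f x))\<^sup>2 + (norm (g x))\<^sup>2)"
    using f g by (simp add: l2_space_def)
  have [measurable]: "f \<in> borel_measurable M" "g \<in> borel_measurable M"
    using f g by (auto simp: l2_space_def)
  show "(\<lambda>x. f x * g x) \<in> borel_measurable M" by measurable
  show "AE x in M. norm (f x * g x) \<le> norm ((norm (f x))\<^sup>2 + (norm (g x))\<^sup>2)"
  proof (rule AE_I2)
    fix x
    have "2 * (norm (f x) * norm (g x)) \<le> (norm (f x))\<^sup>2 + (norm (g x))\<^sup>2"
      using zero_le_power2[of "norm (f x) - norm (g x)"] by (simp add: power2_eq_square algebra_simps)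
    moreover have "0 \<le> norm (f x) * norm (g x)" by simp
    ultimately have "norm (f x) * norm (g x) \<le> (norm (f x))\<^sup>2 + (norm (g x))\<^sup>2" by linarith
    then show "norm (f x * g x) \<le> norm ((norm (f x))\<^sup>2 + (norm (g x))\<^sup>2)"
      by (simp add: norm_mult)
  qed
qed

lemma l2_space_cnj: "f \<in> l2_space M \<Longrightarrow> (\<lambda>x. cnj (f x)) \<in> l2_space M"
  by (auto simp: l2_space_def intro: borel_measurable_continuous_on[OF continuous_on_cnj[OF continuous_on_id]])

lemma l2_norm_nonneg: "l2_norm M f \<ge> 0"
  by (simp add: l2_norm_eq)

lemma nn_integral_l2_norm:
  assumes "f \<in> l2_space M"
  shows "(\<integral>\<^sup>+x. ennreal ((norm (f x))\<^sup>2) \<partial>M) = ennreal ((l2_norm M f)\<^sup>2)"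
  using assms by (subst nn_integral_eq_integral) (auto simp: l2_space_def l2_norm_eq)

text \<open>Cauchy-Schwarz with the norm inside the integral: \<open>bargmann_power_series\<close>
  needs this form to integrate a series term by term. The usual form is
  \<open>norm_l2_inner_le\<close>.\<close>

lemma l2_integral_norm_mult_le:
  assumes f: "f \<in> l2_space M" and g: "g \<in> l2_space M"
  shows "(\<integral>x. norm (f x * g x) \<partial>M) \<le> l2_norm M f * l2_norm M g"
proof -
  have [measurable]: "f \<in> borel_measurable M" "g \<in> borel_measurable M"
    using f g by (auto simp: l2_space_def)
  have int: "integrable M (\<lambda>x. norm (f x * g x))"
    by (rule integrable_norm[OF l2_space_integrable_mult[OF f g]])
  have "ennreal ((\<integral>x. norm (f x * g x) \<partial>M)\<^sup>2) = (\<integral>\<^sup>+x. ennreal (norm (f x)) * ennreal (norm (g x)) \<partial>M)\<^sup>2"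
    using nn_integral_eq_integral[OF int] by (simp add: norm_mult ennreal_mult ennreal_power)
  also have "\<dots> \<le> (\<integral>\<^sup>+x. (ennreal (norm (f x)))\<^sup>2 \<partial>M) * (\<integral>\<^sup>+x. (ennreal (norm (g x)))\<^sup>2 \<partial>M)"
    by (rule Cauchy_Schwarz_nn_integral) measurable
  also have "\<dots> = ennreal ((l2_norm M f * l2_norm M g)\<^sup>2)"
    using nn_integral_l2_norm[OF f] nn_integral_l2_norm[OF g]
    by (simp add: ennreal_power ennreal_mult power_mult_distrib)
  finally have "(\<integral>x. norm (f x * g x) \<partial>M)\<^sup>2 \<le> (l2_norm M f * l2_norm M g)\<^sup>2" by simp
  then show ?thesis by (rule power2_le_imp_le) (simp add: l2_norm_nonneg)
qed

lemma l2_inner_diff_left: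
  assumes "f \<in> l2_space M" "g \<in> l2_space M" "h \<in> l2_space M"
  shows "l2_inner M (f - g) h = l2_inner M f h - l2_inner M g h"
  unfolding l2_inner_def using assms
  by (subst Bochner_Integration.integral_diff[symmetric])
     (auto intro: l2_space_integrable_mult l2_space_cnj simp: left_diff_distrib)

lemma l2_inner_sum_left:
  assumes "\<And>n. n \<in> A \<Longrightarrow> e n \<in> l2_space M" "h \<in> l2_space M"
  shows "l2_inner M (\<lambda>x. \<Sum>n\<in>A. c n * e n x) h = (\<Sum>n\<in>A. c n * l2_inner M (e n) h)"
proof -
  have "integrable M (\<lambda>x. c n * (e n x * cnj (h x)))" if "n \<in> A" for n
    using assms that by (intro integrable_mult_right l2_space_integrable_mult l2_space_cnj)
  then show ?thesis
    unfolding l2_inner_def sum_distrib_right mult.assoc by (subst Bochner_Integration.integral_sum) auto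
qed

lemma l2_inner_commute: "l2_inner M g f = cnj (l2_inner M f g)"
proof -
  have "cnj (l2_inner M f g) = (\<integral>x. cnj (f x * cnj (g x)) \<partial>M)"
    unfolding l2_inner_def by (rule Bochner_Integration.integral_cnj[symmetric])
  then show ?thesis by (simp only: l2_inner_def complex_cnj_mult complex_cnj_cnj mult.commute)
qed

lemma l2_norm_sq: "complex_of_real ((l2_norm M f)\<^sup>2) = l2_inner M f f"
proof -
  have "l2_inner M f f = (\<integral>x. complex_of_real ((norm (f x))\<^sup>2) \<partial>M)"
    unfolding l2_inner_def by (simp only: complex_norm_square)
  then show ?thesis by (simp only: l2_norm_eq integral_complex_of_real) simp
qed

lemma norm_l2_inner_le:
  assumes f: "f \<in> l2_space M" and g: "g \<in> l2_space M"
  shows "norm (l2_inner M f g) \<le> l2_norm M f * l2_norm M g"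
proof -
  have "norm (l2_inner M f g) \<le> (\<integral>x. norm (f x * cnj (g x)) \<partial>M)"
    unfolding l2_inner_def by (rule integral_norm_bound)
  also have "\<dots> \<le> l2_norm M f * l2_norm M (\<lambda>x. cnj (g x))"
    by (rule l2_integral_norm_mult_le[OF f l2_space_cnj[OF g]])
  finally show ?thesis by (simp add: l2_norm_eq)
qed

lemma l2_space_sum:
  assumes "\<And>n. n \<in> A \<Longrightarrow> e n \<in> l2_space M"
  shows "(\<lambda>x. \<Sum>n\<in>A. c n * e n x) \<in> l2_space M"
  using assms
proof (induction A rule: infinite_finite_induct)
  case (insert n A)
  then have "(\<lambda>x. c n * e n x) + (\<lambda>x. \<Sum>n\<in>A. c n * e n x) \<in> l2_space M"
    by (intro l2_space_add l2_space_cmult) auto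
  then show ?case using insert by (simp add: plus_fun_def)
qed (auto simp: l2_space_def)

section \<open>Orthogonal systems\<close>

lemma l2_norm_sum_orthogonal:
  assumes e: "\<And>n. e n \<in> l2_space M" and orth: "\<And>m n. m \<noteq> n \<Longrightarrow> l2_inner M (e m) (e n) = 0"
    and A: "finite A"
  shows "(l2_norm M (\<lambda>x. \<Sum>n\<in>A. c n * e n x))\<^sup>2 = (\<Sum>n\<in>A. (norm (c n))\<^sup>2 * (l2_norm M (e n))\<^sup>2)"
proof -
  let ?s = "\<lambda>x. \<Sum>n\<in>A. c n * e n x"
  have s: "?s \<in> l2_space M" by (rule l2_space_sum[OF e])
  \<comment> \<open>Conjugate symmetry moves the sum to the first slot, where linearity applies;
    orthogonality then leaves one term.\<close>
  have 1: "l2_inner M (e n) ?s = cnj (c n) * l2_inner M (e n) (e n)" if "n \<in> A" for n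
  proof -
    have "l2_inner M (e n) ?s = cnj (\<Sum>k\<in>A. c k * l2_inner M (e k) (e n))"
      by (subst l2_inner_commute) (simp only: l2_inner_sum_left[OF e e])
    also have "(\<Sum>k\<in>A. c k * l2_inner M (e k) (e n)) = (\<Sum>k\<in>A. if k = n then c n * l2_inner M (e n) (e n) else 0)"
      using orth by (intro sum.cong) auto
    finally show ?thesis using A that by (simp add: l2_inner_commute[of M "e n" "e n", symmetric])
  qed
  have "complex_of_real ((l2_norm M ?s)\<^sup>2) = (\<Sum>n\<in>A. c n * l2_inner M (e n) ?s)"
    unfolding l2_norm_sq by (rule l2_inner_sum_left[OF e s])
  also have "\<dots> = (\<Sum>n\<in>A. c n * cnj (c n) * l2_inner M (e n) (e n))"
    using 1 by (intro sum.cong) auto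
  also have "\<dots> = complex_of_real (\<Sum>n\<in>A. (norm (c n))\<^sup>2 * (l2_norm M (e n))\<^sup>2)"
    by (simp only: of_real_sum of_real_mult complex_norm_square l2_norm_sq[symmetric])
  finally show ?thesis by (simp only: of_real_eq_iff)
qed

text \<open>The function \<open>?s\<close> is the orthogonal projection of \<open>f\<close> onto the
  span of the \<open>e n\<close> with \<open>n \<in> A\<close>. The gap in the inequality is the
  squared norm of \<open>f - ?s\<close>.\<close>

lemma bessel_inequality:
  assumes f: "f \<in> l2_space M" and e: "\<And>n. e n \<in> l2_space M" 
    and orth: "\<And>m n. m \<noteq> n \<Longrightarrow> l2_inner M (e m) (e n) = 0" and pos: "\<And>n. l2_norm M (e n) > 0"
    and A: "finite A"
  shows "(\<Sum>n\<in>A. (norm (l2_inner M f (e n)))\<^sup>2 / (l2_norm M (e n))\<^sup>2) \<le> (l2_norm M f)\<^sup>2"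
proof -
  define c where "c n = l2_inner M f (e n) / of_real ((l2_norm M (e n))\<^sup>2)" for n
  let ?s = "\<lambda>x. \<Sum>n\<in>A. c n * e n x"
  let ?S = "\<Sum>n\<in>A. (norm (l2_inner M f (e n)))\<^sup>2 / (l2_norm M (e n))\<^sup>2"
  have s: "?s \<in> l2_space M" by (rule l2_space_sum[OF e])
  have "(l2_norm M ?s)\<^sup>2 = (\<Sum>n\<in>A. (norm (c n))\<^sup>2 * (l2_norm M (e n))\<^sup>2)"
    by (rule l2_norm_sum_orthogonal[OF e orth A])
  also have "\<dots> = ?S"
  proof (intro sum.cong refl)
    fix n
    have "norm (c n) = norm (l2_inner M f (e n)) / (l2_norm M (e n))\<^sup>2"
      by (simp add: c_def norm_divide norm_power)
    then show "(norm (c n))\<^sup>2 * (l2_norm M (e n))\<^sup>2 = (norm (l2_inner M f (e n)))\<^sup>2 / (l2_norm M (e n))\<^sup>2"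
      using pos[of n] by (simp add: field_simps power2_eq_square)
  qed
  finally have ss: "(l2_norm M ?s)\<^sup>2 = ?S" .
  have sf: "l2_inner M ?s f = of_real ?S"
    unfolding l2_inner_sum_left[OF e f] of_real_sum
  proof (intro sum.cong refl)
    fix n
    have "l2_inner M (e n) f = cnj (l2_inner M f (e n))" by (rule l2_inner_commute)
    then show "c n * l2_inner M (e n) f = of_real ((norm (l2_inner M f (e n)))\<^sup>2 / (l2_norm M (e n))\<^sup>2)"
      unfolding c_def of_real_divide complex_norm_square by simp
  qed
  have fs: "l2_inner M f ?s = of_real ?S"
    unfolding l2_inner_commute[of M f ?s] sf by simp
  have "complex_of_real ((l2_norm M (f - ?s))\<^sup>2) = l2_inner M f (f - ?s) - l2_inner M ?s (f - ?s)"
    unfolding l2_norm_sq by (rule l2_inner_diff_left[OF f s l2_space_diff[OF f s]])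
  also have "\<dots> = cnj (l2_inner M (f - ?s) f) - cnj (l2_inner M (f - ?s) ?s)"
    by (simp only: l2_inner_commute[symmetric])
  also have "\<dots> = cnj (of_real ((l2_norm M f)\<^sup>2) - l2_inner M ?s f) - cnj (l2_inner M f ?s - of_real ((l2_norm M ?s)\<^sup>2))"
    by (simp only: l2_inner_diff_left[OF f s f] l2_inner_diff_left[OF f s s] l2_norm_sq)
  also have "\<dots> = of_real ((l2_norm M f)\<^sup>2 - ?S)"
    unfolding sf fs ss by simp
  finally have "(l2_norm M (f - ?s))\<^sup>2 = (l2_norm M f)\<^sup>2 - ?S" by (simp only: of_real_eq_iff)
  moreover have "(l2_norm M (f - ?s))\<^sup>2 \<ge> 0" by simp
  ultimately show ?thesis by linarith
qed

section \<open>Completeness of the space of square integrable functions\<close>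

lemma l2_dist_commute: "l2_dist M f g = l2_dist M g f"
  by (simp add: l2_dist_def l2_norm_eq norm_minus_commute)

text \<open>On a finite measure the geometric bound on the increments passes from the L2 norm to the
  L1 norm. So the increments are absolutely summable almost everywhere, and their telescoping sums
  converge.\<close>

lemma l2_cauchy_subsequence_AE_convergent:
  assumes M: "finite_measure M" and v: "\<And>k. v k \<in> l2_space M"
    and dist: "\<And>k. l2_dist M (v k) (v (Suc k)) \<le> (1/2) ^ k"
  shows "AE x in M. convergent (\<lambda>k. v k x)"
proof -
  interpret finite_measure M by (rule M)
  define w where "w k = v k - v (Suc k)" for k
  have w: "w k \<in> l2_space M" for k unfolding w_def by (intro l2_space_diff v)
  have [measurable]: "w k \<in> borel_measurable M" for k using w by (simp add: l2_space_def)
  have wn: "(l2_norm M (w k))\<^sup>2 \<le> ((1/2) ^ k)\<^sup>2" for k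
    using dist[of k] by (intro power_mono) (auto simp: w_def l2_dist_def l2_norm_nonneg)
  have bound: "(\<integral>\<^sup>+x. ennreal (norm (w k x)) \<partial>M) \<le> ennreal ((1/2) ^ k * (measure M (space M) + 1))" for k
  proof -
    \<comment> \<open>This takes the place of Cauchy-Schwarz against the constant 1. With b =
      (1/2)^k and squared norm at most b^2, integration gives b times the total mass plus b.\<close>
    have le: "norm (w k x) \<le> (1/2) ^ k + 2 ^ k * (norm (w k x))\<^sup>2" for x
    proof -
      define a b :: real where "a = norm (w k x)" and "b = (1/2) ^ k"
      have b: "b > 0" "2 ^ k = 1 / b" by (auto simp: b_def power_divide)
      have "0 \<le> (a - b)\<^sup>2 + a * b" using b by (simp add: a_def)
      then have "a * b \<le> b\<^sup>2 + a\<^sup>2" by (simp add: power2_eq_square algebra_simps)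
      then have "a \<le> b + (1 / b) * a\<^sup>2" using b by (simp add: field_simps power2_eq_square)
      then show ?thesis unfolding b a_def b_def .
    qed
    have "(\<integral>\<^sup>+x. ennreal (norm (w k x)) \<partial>M) \<le> 
       (\<integral>\<^sup>+x. ennreal ((1/2) ^ k) + ennreal (2 ^ k) * ennreal ((norm (w k x))\<^sup>2) \<partial>M)"
      using le by (intro nn_integral_mono) (simp add: ennreal_plus[symmetric] ennreal_mult[symmetric] del: ennreal_plus)
    also have "\<dots> = ennreal ((1/2) ^ k * measure M (space M) + 2 ^ k * (l2_norm M (w k))\<^sup>2)"
      by (simp add: nn_integral_add nn_integral_cmult nn_integral_l2_norm[OF w] emeasure_eq_measure 
          ennreal_mult ennreal_plus)
    also have "\<dots> \<le> ennreal ((1/2) ^ k * measure M (space M) + 2 ^ k * ((1/2) ^ k)\<^sup>2)"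
      using wn by (intro ennreal_leI add_left_mono mult_left_mono) auto
    also have "2 ^ k * ((1/2) ^ k)\<^sup>2 = ((1/2)::real) ^ k" by (simp add: power2_eq_square power_divide)
    finally show ?thesis by (simp only: distrib_left mult_1_right)
  qed
  have "(\<integral>\<^sup>+x. (\<Sum>k. ennreal (norm (w k x))) \<partial>M) = (\<Sum>k. \<integral>\<^sup>+x. ennreal (norm (w k x)) \<partial>M)"
    by (rule nn_integral_suminf) measurable
  also have "\<dots> \<le> (\<Sum>k. ennreal ((1/2) ^ k * (measure M (space M) + 1)))"
    by (intro suminf_le bound summableI)
  also have "\<dots> < \<infinity>"
    by (subst suminf_ennreal2) (auto intro!: summable_mult2)
  finally have "AE x in M. (\<Sum>k. ennreal (norm (w k x))) \<noteq> \<infinity>"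
    by (intro nn_integral_PInf_AE) auto
  then show ?thesis
  proof (rule AE_mp, intro AE_I2 impI)
    fix x assume "(\<Sum>k. ennreal (norm (w k x))) \<noteq> \<infinity>"
    then have "summable (\<lambda>k. norm (w k x))" by (intro summable_suminf_not_top) auto
    then have "summable (\<lambda>k. w k x)" by (rule summable_norm_cancel)
    then have "convergent (\<lambda>n. \<Sum>k<n. w k x)" by (simp add: summable_iff_convergent)
    moreover have "(\<Sum>k<n. w k x) = v 0 x - v n x" for n
      by (induction n) (auto simp: w_def)
    ultimately have "convergent (\<lambda>n. v 0 x - v n x)" by simp
    from convergent_diff[OF convergent_const[of "v 0 x"] this] show "convergent (\<lambda>n. v n x)" by simp
  qed
qed

text \<open>The limit is taken pointwise along a fast subsequence; Fatou's lemma then gives both its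
  square integrability and the convergence in norm of the whole sequence.\<close>

lemma riesz_fischer:
  assumes M: "finite_measure M" and u: "\<And>k. u k \<in> l2_space M"
    and cauchy: "\<And>\<epsilon>. \<epsilon> > 0 \<Longrightarrow> \<exists>N. \<forall>m\<ge>N. \<forall>n\<ge>N. l2_dist M (u m) (u n) < \<epsilon>"
  obtains f where "f \<in> l2_space M" "(\<lambda>k. l2_dist M f (u k)) \<longlonglongrightarrow> 0"
proof -
  obtain N where N: "\<And>j m n. m \<ge> N j \<Longrightarrow> n \<ge> N j \<Longrightarrow> l2_dist M (u m) (u n) < (1/2) ^ j"
    using cauchy[of "(1/2) ^ j" for j] by (metis zero_less_divide_1_iff zero_less_numeral zero_less_power)
  \<comment> \<open>The sum makes \<open>r\<close> monotone with \<open>r j \<ge> N j\<close>. The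
    summand \<open>j\<close> gives \<open>r j \<ge> j\<close>, so that
    \<open>r (j + K) \<ge> K\<close> below.\<close>
  define r where "r j = j + (\<Sum>i\<le>j. N i)" for j
  have rN: "r j \<ge> N j" for j unfolding r_def by (intro trans_le_add2 member_le_sum) auto
  have r_mono: "r i \<le> r j" if "i \<le> j" for i j 
    unfolding r_def using that by (intro add_mono sum_mono2) auto
  define v where "v j = u (r j)" for j
  have v: "v j \<in> l2_space M" for j using u by (simp add: v_def)
  have [measurable]: "u j \<in> borel_measurable M" "v j \<in> borel_measurable M" for j 
    using u v by (auto simp: l2_space_def)
  have "AE x in M. convergent (\<lambda>k. v k x)"
  proof (rule l2_cauchy_subsequence_AE_convergent[OF M v])
    show "l2_dist M (v k) (v (Suc k)) \<le> (1/2) ^ k" for k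
      unfolding v_def by (intro less_imp_le N rN order_trans[OF rN r_mono]) auto
  qed
  \<comment> \<open>Where \<open>v k x\<close> diverges, \<open>lim\<close> is one unspecified
    constant. This concerns a null set only and keeps \<open>f\<close> measurable.\<close>
  moreover define f where "f x = lim (\<lambda>k. v k x)" for x
  ultimately have lim: "AE x in M. (\<lambda>k. v k x) \<longlonglongrightarrow> f x"
    by (auto simp: convergent_LIMSEQ_iff)
  have f_meas [measurable]: "f \<in> borel_measurable M"
    unfolding f_def by (rule borel_measurable_lim_metric) measurable
  have bound: "(\<integral>\<^sup>+x. ennreal ((norm (f x - u n x))\<^sup>2) \<partial>M) \<le> ennreal (\<epsilon>\<^sup>2)"
    if K: "\<And>m. m \<ge> K \<Longrightarrow> l2_dist M (u m) (u n) \<le> \<epsilon>" for n K \<epsilon>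
  proof -
    have "(\<integral>\<^sup>+x. ennreal ((norm (f x - u n x))\<^sup>2) \<partial>M) = 
        (\<integral>\<^sup>+x. liminf (\<lambda>j. ennreal ((norm (v (j + K) x - u n x))\<^sup>2)) \<partial>M)"
    proof (rule nn_integral_cong_AE, use lim in eventually_elim)
      fix x assume "(\<lambda>k. v k x) \<longlonglongrightarrow> f x"
      then have "(\<lambda>j. ennreal ((norm (v (j + K) x - u n x))\<^sup>2)) \<longlonglongrightarrow> ennreal ((norm (f x - u n x))\<^sup>2)"
        by (intro tendsto_intros tendsto_ennrealI) (rule LIMSEQ_ignore_initial_segment)
      then show "ennreal ((norm (f x - u n x))\<^sup>2) = liminf (\<lambda>j. ennreal ((norm (v (j + K) x - u n x))\<^sup>2))"
        by (intro lim_imp_Liminf[symmetric]) auto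
    qed
    also have "\<dots> \<le> liminf (\<lambda>j. \<integral>\<^sup>+x. ennreal ((norm (v (j + K) x - u n x))\<^sup>2) \<partial>M)"
      by (rule nn_integral_liminf) measurable
    also have "\<dots> \<le> liminf (\<lambda>j. ennreal (\<epsilon>\<^sup>2))"
    proof (intro Liminf_mono always_eventually allI)
      fix j
      have d: "v (j + K) - u n \<in> l2_space M" by (intro l2_space_diff u v)
      have "l2_norm M (v (j + K) - u n) \<le> \<epsilon>"
        using K[of "r (j + K)"] by (simp add: l2_dist_def v_def r_def)
      then have "ennreal ((l2_norm M (v (j + K) - u n))\<^sup>2) \<le> ennreal (\<epsilon>\<^sup>2)"
        by (intro ennreal_leI power_mono l2_norm_nonneg)
      then show "(\<integral>\<^sup>+x. ennreal ((norm (v (j + K) x - u n x))\<^sup>2) \<partial>M) \<le> ennreal (\<epsilon>\<^sup>2)"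
        unfolding nn_integral_l2_norm[OF d, symmetric] by simp
    qed
    finally show ?thesis by (simp add: Liminf_const)
  qed
  have diff: "f - u n \<in> l2_space M \<and> l2_dist M f (u n) \<le> \<epsilon>"
    if K: "\<And>m. m \<ge> K \<Longrightarrow> l2_dist M (u m) (u n) \<le> \<epsilon>" and "\<epsilon> \<ge> 0" for n K \<epsilon>
  proof -
    have meas: "f - u n \<in> borel_measurable M" unfolding fun_diff_def by measurable
    have le: "(\<integral>\<^sup>+x. ennreal ((norm ((f - u n) x))\<^sup>2) \<partial>M) \<le> ennreal (\<epsilon>\<^sup>2)" 
      using bound[OF K] by simp
    also have "\<dots> < \<infinity>" by simp
    finally have l2: "f - u n \<in> l2_space M" 
      using meas by (simp add: l2_space_def integrable_iff_bounded)
    have "(l2_norm M (f - u n))\<^sup>2 \<le> \<epsilon>\<^sup>2" 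
      using le unfolding nn_integral_l2_norm[OF l2] by simp
    then have "l2_norm M (f - u n) \<le> \<epsilon>" using \<open>\<epsilon> \<ge> 0\<close> by (rule power2_le_imp_le)
    then show ?thesis using l2 by (simp add: l2_dist_def)
  qed
  \<comment> \<open>From \<open>N 0\<close> on all distances are below \<open>(1/2) ^ 0 = 1\<close>;
    the bound with \<epsilon> = 1 is enough to put \<open>f\<close> itself into the space.\<close>
  have "f - u (N 0) \<in> l2_space M"
    using diff[of "N 0" "N 0" 1] N[of 0] by (auto intro: less_imp_le)
  from l2_space_add[OF this u[of "N 0"]] have f: "f \<in> l2_space M"
    by (simp add: fun_diff_def plus_fun_def)
  have "(\<lambda>k. l2_dist M f (u k)) \<longlonglongrightarrow> 0"
  proof (rule LIMSEQ_I)
    fix \<epsilon> :: real assume "\<epsilon> > 0"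
    then obtain K where K: "\<forall>m\<ge>K. \<forall>n\<ge>K. l2_dist M (u m) (u n) < \<epsilon> / 2" using cauchy[of "\<epsilon> / 2"] by auto
    have "l2_dist M f (u n) < \<epsilon>" if "n \<ge> K" for n
    proof -
      have "l2_dist M (u m) (u n) \<le> \<epsilon> / 2" if "m \<ge> K" for m
        using K that \<open>n \<ge> K\<close> by (meson less_imp_le)
      from diff[of K n "\<epsilon> / 2", OF this] \<open>\<epsilon> > 0\<close> show ?thesis by simp
    qed
    moreover have "l2_dist M f (u n) \<ge> 0" for n by (simp add: l2_dist_def l2_norm_nonneg)
    ultimately show "\<exists>no. \<forall>n\<ge>no. norm (l2_dist M f (u n) - 0) < \<epsilon>" by auto
  qed
  with f show thesis by (rule that)
qed

subsection \<open>Rotation invariance of the Lebesgue measure\<close>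

lemma borel_measurable_fst_snd [measurable]:
  "(fst :: 'a::topological_space \<times> 'b::topological_space \<Rightarrow> 'a) \<in> borel_measurable borel"
  "(snd :: 'a \<times> 'b \<Rightarrow> 'b) \<in> borel_measurable borel"
  by (intro borel_measurable_continuous_onI continuous_intros)+

lemma nn_integral_pair_shear_fst:
  fixes f :: "real \<times> real \<Rightarrow> ennreal"
  assumes [measurable]: "f \<in> borel_measurable borel"
  shows "(\<integral>\<^sup>+p. f (fst p + t * snd p, snd p) \<partial>lborel) = (\<integral>\<^sup>+p. f p \<partial>lborel)"
proof -
  have [measurable]: "f \<in> borel_measurable (lborel \<Otimes>\<^sub>M lborel)"
    using assms by (simp add: lborel_prod)
  have tr: "(\<integral>\<^sup>+x. f (x + t * y, y) \<partial>lborel) = (\<integral>\<^sup>+x. f (x, y) \<partial>lborel)" for y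
    by (subst (2) lborel_distr_plus[of "t * y", symmetric], subst nn_integral_distr)
       (auto simp: add.commute)
  have "(\<integral>\<^sup>+p. f (fst p + t * snd p, snd p) \<partial>(lborel \<Otimes>\<^sub>M lborel))
      = (\<integral>\<^sup>+y. \<integral>\<^sup>+x. f (x + t * y, y) \<partial>lborel \<partial>lborel)"
    by (subst lborel_pair.nn_integral_snd[symmetric]) auto
  also have "\<dots> = (\<integral>\<^sup>+p. f p \<partial>(lborel \<Otimes>\<^sub>M lborel))"
    unfolding tr by (subst lborel_pair.nn_integral_snd[symmetric]) auto
  finally show ?thesis by (simp add: lborel_prod)
qed

lemma nn_integral_pair_shear_snd:
  fixes f :: "real \<times> real \<Rightarrow> ennreal"
  assumes [measurable]: "f \<in> borel_measurable borel"
  shows "(\<integral>\<^sup>+p. f (fst p, snd p + t * fst p) \<partial>lborel) = (\<integral>\<^sup>+p. f p \<partial>lborel)"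
proof -
  have [measurable]: "f \<in> borel_measurable (lborel \<Otimes>\<^sub>M lborel)"
    using assms by (simp add: lborel_prod)
  have tr: "(\<integral>\<^sup>+y. f (x, y + t * x) \<partial>lborel) = (\<integral>\<^sup>+y. f (x, y) \<partial>lborel)" for x
    by (subst (2) lborel_distr_plus[of "t * x", symmetric], subst nn_integral_distr)
       (auto simp: add.commute)
  have "(\<integral>\<^sup>+p. f (fst p, snd p + t * fst p) \<partial>(lborel \<Otimes>\<^sub>M lborel))
      = (\<integral>\<^sup>+x. \<integral>\<^sup>+y. f (x, y + t * x) \<partial>lborel \<partial>lborel)"
    by (subst lborel.nn_integral_fst[symmetric]) auto
  also have "\<dots> = (\<integral>\<^sup>+p. f p \<partial>(lborel \<Otimes>\<^sub>M lborel))"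
    unfolding tr by (subst lborel.nn_integral_fst[symmetric]) auto
  finally show ?thesis by (simp add: lborel_prod)
qed

lemma measurable_Complex [measurable (raw)]:
  assumes "f \<in> borel_measurable M" "g \<in> borel_measurable M"
  shows "(\<lambda>x. Complex (f x) (g x)) \<in> borel_measurable M"
  using assms unfolding Complex_eq by measurable

text \<open>Carries integrals over the complex plane to the real plane, where shears act. Lebesgue
  measure is recognised by its values on boxes.\<close>

lemma lborel_complex_eq_distr:
  "(lborel :: complex measure) = distr lborel borel (\<lambda>p. Complex (fst p) (snd p))"
proof (rule lborel_eqI)
  fix l u :: complex
  assume le: "\<And>b. b \<in> Basis \<Longrightarrow> l \<bullet> b \<le> u \<bullet> b"
  have "(\<lambda>p. Complex (fst p) (snd p)) -` box l u = box (Re l, Im l) (Re u, Im u)"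
    by (auto simp: mem_box Basis_complex_def Basis_prod_def)
  then show "emeasure (distr lborel borel (\<lambda>p. Complex (fst p) (snd p))) (box l u) 
      = (\<Prod>b\<in>Basis. (u - l) \<bullet> b)"
    using le[of 1] le[of \<i>]
    by (subst emeasure_distr)
       (auto simp: emeasure_lborel_box_eq Basis_complex_def Basis_prod_def prod.union_disjoint)
qed simp

lemma nn_integral_complex_rotate:
  fixes f :: "complex \<Rightarrow> ennreal"
  assumes [measurable]: "f \<in> borel_measurable borel" and c: "norm c = 1" "Re c \<noteq> -1"
  shows "(\<integral>\<^sup>+z. f (c * z) \<partial>lborel) = (\<integral>\<^sup>+z. f z \<partial>lborel)"
proof -
  \<comment> \<open>A rotation by \<open>\<theta>\<close> is a product of three shears, with factors \<open>-tan (\<theta>/2)\<close>, \<open>sin \<theta>\<close>, \<open>-tan (\<theta>/2)\<close>.\<close>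
  define a b t where "a = Re c" and "b = Im c" and "t = - Im c / (1 + Re c)"
  have ab: "a\<^sup>2 + b\<^sup>2 = 1" using c(1) unfolding a_def b_def cmod_def by simp
  \<comment> \<open>The quotient tan (\<theta>/2) = sin \<theta> / (1 + cos \<theta>) is undefined
    exactly at the half turn, which \<open>Re c \<noteq> -1\<close> excludes.\<close>
  have a1: "1 + a \<noteq> 0" using c(2) by (auto simp: a_def)
  have tb: "t * b = a - 1"
  proof -
    have "t * (1 + a) = - b" using a1 by (simp add: t_def a_def b_def)
    then have "(t * b) * (1 + a) = - b\<^sup>2" by (simp add: power2_eq_square algebra_simps)
    also have "\<dots> = (a - 1) * (1 + a)" using ab by (simp add: power2_eq_square algebra_simps)
    finally show ?thesis using a1 by simp
  qed
  have ta: "t * (1 + a) = - b" using a1 by (simp add: t_def a_def b_def)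
  have mul: "c * Complex x y = Complex ((x + t * y) + t * (y + b * (x + t * y))) (y + b * (x + t * y))" for x y
  proof -
    have im: "y + b * (x + t * y) = b * x + a * y"
    proof -
      have "y + b * (x + t * y) = b * x + (1 + t * b) * y" by (simp add: algebra_simps)
      then show ?thesis unfolding tb by simp
    qed
    have "(x + t * y) + t * (b * x + a * y) = (1 + t * b) * x + t * (1 + a) * y"
      by (simp add: algebra_simps)
    also have "\<dots> = a * x - b * y" using tb ta by simp
    finally show ?thesis unfolding im by (simp add: complex_eq_iff a_def b_def)
  qed
  let ?F = "\<lambda>p::real\<times>real. f (Complex (fst p) (snd p))"
  let ?G = "\<lambda>p. ?F (fst p + t * snd p, snd p)"
  let ?H = "\<lambda>p. ?G (fst p, snd p + b * fst p)"
  have [measurable]: "?F \<in> borel_measurable borel" by measurable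
  have pair [measurable]: "(\<lambda>p. (u p, v p)) \<in> borel_measurable borel" 
    if [measurable]: "u \<in> borel_measurable borel" "v \<in> borel_measurable borel" 
    for u v :: "real \<times> real \<Rightarrow> real"
    by (rule borel_measurable_Pair) measurable
  have [measurable]: "?G \<in> borel_measurable borel" by measurable
  have [measurable]: "?H \<in> borel_measurable borel" by measurable
  have "(\<integral>\<^sup>+z. f (c * z) \<partial>lborel) = (\<integral>\<^sup>+p. ?H (fst p + t * snd p, snd p) \<partial>lborel)"
    by (subst lborel_complex_eq_distr, subst nn_integral_distr) (auto simp: mul)
  also have "\<dots> = (\<integral>\<^sup>+p. ?H p \<partial>lborel)" by (rule nn_integral_pair_shear_fst) measurable
  also have "\<dots> = (\<integral>\<^sup>+p. ?G p \<partial>lborel)" by (rule nn_integral_pair_shear_snd) measurable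
  also have "\<dots> = (\<integral>\<^sup>+p. ?F p \<partial>lborel)" by (rule nn_integral_pair_shear_fst) measurable
  also have "\<dots> = (\<integral>\<^sup>+z. f z \<partial>lborel)"
    by (subst lborel_complex_eq_distr, subst nn_integral_distr) auto
  finally show ?thesis .
qed

text \<open>Fubini allows the coordinates to be rotated one at a time: the inner one for fixed
  \<open>z\<close>, then \<open>z\<close> as the argument of the inner integral.\<close>

lemma lborel_complex_pair_rotate:
  fixes c :: complex
  assumes c: "norm c = 1" "Re c \<noteq> -1"
  shows "distr lborel borel (\<lambda>p. (c * fst p, c * snd p)) = (lborel :: (complex \<times> complex) measure)"
proof (rule measure_eqI)
  fix A :: "(complex \<times> complex) set"
  assume "A \<in> sets (distr lborel borel (\<lambda>p. (c * fst p, c * snd p)))"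
  then have [measurable]: "A \<in> sets borel" by simp
  have "A \<in> sets (lborel \<Otimes>\<^sub>M lborel)" unfolding lborel_prod by simp
  then have [measurable]: "A \<in> sets (borel \<Otimes>\<^sub>M borel)" by (simp cong: sets_pair_measure_cong)
  let ?i = "indicator A :: complex \<times> complex \<Rightarrow> ennreal"
  have "(\<integral>\<^sup>+p. ?i (c * fst p, c * snd p) \<partial>(lborel \<Otimes>\<^sub>M lborel))
      = (\<integral>\<^sup>+z. \<integral>\<^sup>+w. ?i (c * z, c * w) \<partial>lborel \<partial>lborel)"
    by (subst lborel.nn_integral_fst[symmetric]) auto
  also have "\<dots> = (\<integral>\<^sup>+z. \<integral>\<^sup>+w. ?i (c * z, w) \<partial>lborel \<partial>lborel)"
    by (intro nn_integral_cong nn_integral_complex_rotate[where f = "\<lambda>w. ?i (c * _, w)"] c) measurable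
  also have "\<dots> = (\<integral>\<^sup>+z. \<integral>\<^sup>+w. ?i (z, w) \<partial>lborel \<partial>lborel)"
    by (intro nn_integral_complex_rotate[where f = "\<lambda>z. \<integral>\<^sup>+w. ?i (z, w) \<partial>lborel"] c) measurable
  also have "\<dots> = (\<integral>\<^sup>+p. ?i p \<partial>(lborel \<Otimes>\<^sub>M lborel))"
    by (subst lborel.nn_integral_fst[symmetric]) auto
  finally have "(\<integral>\<^sup>+p. ?i (c * fst p, c * snd p) \<partial>lborel) = emeasure lborel A"
    by (simp add: lborel_prod)
  then show "emeasure (distr lborel borel (\<lambda>p. (c * fst p, c * snd p))) A = emeasure lborel A"
    by (subst nn_integral_indicator[symmetric], simp, subst nn_integral_distr) auto
qed simp

lemma gauss_measure_rotate:
  fixes c :: complex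
  assumes c: "norm c = 1" "Re c \<noteq> -1"
  shows "distr (gauss_measure \<nu>) borel (\<lambda>p. (c * fst p, c * snd p)) = 
    (gauss_measure \<nu> :: (complex \<times> complex) measure)"
proof -
  have nrm: "norm (c * fst p, c * snd p) = norm p" for p :: "complex \<times> complex"
    using c(1) by (simp add: norm_prod_def norm_mult)
  let ?T = "\<lambda>p::complex\<times>complex. (c * fst p, c * snd p)"
  have "gauss_measure \<nu> = density (distr lborel borel ?T) (\<lambda>x. ennreal (exp (- \<nu> * (norm x)\<^sup>2)))"
    unfolding gauss_measure_def lborel_complex_pair_rotate[OF c] ..
  also have "\<dots> = distr (density lborel (\<lambda>x. ennreal (exp (- \<nu> * (norm (?T x))\<^sup>2)))) borel ?T"
    by (rule density_distr) (auto intro!: borel_measurable_continuous_onI continuous_intros)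
  finally show ?thesis unfolding nrm by (simp add: gauss_measure_def)
qed

subsection \<open>Parseval identity for power series in \<open>z + \<i> w\<close>\<close>

lemma sets_gauss_measure [simp, measurable_cong]: "sets (gauss_measure \<nu>) = sets borel"
  by (simp add: gauss_measure_def)

lemma space_gauss_measure [simp]: "space (gauss_measure \<nu>) = UNIV"
  by (simp add: gauss_measure_def)

lemma measurable_gauss_measure1 [simp]: "measurable (gauss_measure \<nu>) N = measurable borel N"
  by (rule measurable_cong_sets) simp_all

lemma integral_gauss_measure:
  fixes f :: "'a::euclidean_space \<Rightarrow> 'b::{banach, second_countable_topology}"
  assumes [measurable]: "f \<in> borel_measurable borel"
  shows "integral\<^sup>L (gauss_measure \<nu>) f = (\<integral>x. exp (- \<nu> * (norm x)\<^sup>2) *\<^sub>R f x \<partial>lborel)"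
  unfolding gauss_measure_def by (rule integral_density) auto

lemma integrable_gauss_measure:
  fixes f :: "'a::euclidean_space \<Rightarrow> 'b::{banach, second_countable_topology}"
  assumes [measurable]: "f \<in> borel_measurable borel"
  shows "integrable (gauss_measure \<nu>) f \<longleftrightarrow> 
    integrable lborel (\<lambda>x. exp (- \<nu> * (norm x)\<^sup>2) *\<^sub>R f x)"
  unfolding gauss_measure_def by (rule integrable_density) auto

lemma nn_integral_gauss_measure:
  fixes f :: "'a::euclidean_space \<Rightarrow> ennreal"
  assumes [measurable]: "f \<in> borel_measurable borel"
  shows "(\<integral>\<^sup>+x. f x \<partial>gauss_measure \<nu>) = (\<integral>\<^sup>+x. ennreal (exp (- \<nu> * (norm x)\<^sup>2)) * f x \<partial>lborel)"
  unfolding gauss_measure_def by (rule nn_integral_density) auto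

lemma integrable_gauss_measure_cball:
  fixes f :: "'a::euclidean_space \<Rightarrow> 'b::{banach, second_countable_topology}"
  assumes f: "continuous_on UNIV f"
  shows "integrable (gauss_measure \<nu>) (\<lambda>x. indicator (cball a R) x *\<^sub>R f x)"
proof -
  have [measurable]: "f \<in> borel_measurable borel" 
    using f by (rule borel_measurable_continuous_onI)
  have "integrable lborel (\<lambda>x. indicator (cball a R) x *\<^sub>R (exp (- \<nu> * (norm x)\<^sup>2) *\<^sub>R f x))"
    by (intro borel_integrable_compact continuous_intros continuous_on_subset[OF f]) auto
  moreover have "(\<lambda>x. indicator (cball a R) x *\<^sub>R f x) \<in> borel_measurable borel"
    by (intro borel_measurable_scaleR borel_measurable_indicator) auto
  ultimately show ?thesis
    by (subst integrable_gauss_measure) (auto simp: mult.commute)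
qed

text \<open>Continuity from below for the measure with density \<open>f\<close>.\<close>

lemma nn_integral_gauss_measure_cball_SUP:
  fixes f :: "'a::euclidean_space \<Rightarrow> ennreal"
  assumes [measurable]: "f \<in> borel_measurable borel"
  shows "(SUP k::nat. \<integral>\<^sup>+x. f x * indicator (cball 0 (real k)) x \<partial>gauss_measure \<nu>) 
    = (\<integral>\<^sup>+x. f x \<partial>gauss_measure \<nu>)"
proof -
  let ?D = "density (gauss_measure \<nu>) f"
  have UN: "(\<Union>k::nat. cball (0::'a) (real k)) = UNIV"
    using real_arch_simple by (fastforce simp: dist_norm)
  have "(SUP k::nat. emeasure ?D (cball 0 (real k))) = emeasure ?D (\<Union>k::nat. cball 0 (real k))"
    by (rule SUP_emeasure_incseq) (auto simp: incseq_def)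
  then show ?thesis by (simp add: UN emeasure_density)
qed

lemma e_fun_eq: "e_fun m p = (fst p + \<i> * snd p) ^ m"
  by (simp add: e_fun_def split_beta)

lemma continuous_on_e_fun [continuous_intros]: 
  "continuous_on A f \<Longrightarrow> continuous_on A (\<lambda>x. e_fun m (f x))"
  unfolding e_fun_eq by (intro continuous_intros)

lemma borel_measurable_e_fun [measurable]: "e_fun m \<in> borel_measurable borel"
  by (intro borel_measurable_continuous_onI continuous_intros)

text \<open>Rotating both coordinates by \<open>c\<close> preserves the measure and
  \<open>norm p\<close> and multiplies the integrand by \<open>c ^ m * cnj c ^ n\<close>. If this
  factor is not 1, the integral vanishes. The radial factor \<phi> is later the indicator of
  \<open>{..R}\<close> for orthogonality on a ball, and 1 for the whole space.\<close>

lemma integral_e_fun_orthogonal: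
  fixes \<phi> :: "real \<Rightarrow> real"
  assumes [measurable]: "\<phi> \<in> borel_measurable borel" and mn: "m \<noteq> n"
  shows "(\<integral>p. \<phi> (norm p) *\<^sub>R (e_fun m p * cnj (e_fun n p)) \<partial>gauss_measure \<nu>) = 0"
proof -
  \<comment> \<open>Chosen so that \<open>(m - n) * \<theta>\<close> is pi/2 or -pi/2, which makes
    the factor purely imaginary. Since m and n differ by at least 1, also \<theta> \<le> pi/2, hence
    \<open>Re c \<ge> 0\<close>, away from the excluded value -1.\<close>
  define \<theta> where "\<theta> = pi / 2 / \<bar>real m - real n\<bar>"
  define c where "c = cis \<theta>"
  have d1: "\<bar>real m - real n\<bar> \<ge> 1" using mn by linarith
  have \<theta>: "0 < \<theta>" "\<theta> \<le> pi / 2" 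
    using d1 pi_gt_zero by (auto simp: \<theta>_def field_simps intro: mult_left_mono)
  have c: "norm c = 1" "Re c \<noteq> -1"
    using cos_ge_zero[of \<theta>] \<theta> by (auto simp: c_def)
  let ?\<kappa> = "c ^ m * cnj c ^ n"
  have \<kappa>: "?\<kappa> \<noteq> 1"
  proof -
    have d: "d * (pi / 2 / d) = pi / 2" if "d > 0" for d :: real using that by simp
    have k: "?\<kappa> = cis ((real m - real n) * \<theta>)"
      unfolding c_def cis_cnj Complex.DeMoivre cis_mult by (simp add: algebra_simps)
    have "(real m - real n) * \<theta> = pi / 2 \<or> (real m - real n) * \<theta> = - (pi / 2)"
    proof (cases "m > n")
      case True
      then have "real m - real n > 0" by simp
      then have "(real m - real n) * \<theta> = pi / 2" 
        unfolding \<theta>_def by (simp only: abs_of_pos d)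
      then show ?thesis ..
    next
      case False
      then have "real n - real m > 0" using mn by simp
      then have "(real n - real m) * \<theta> = pi / 2" 
        unfolding \<theta>_def by (subst abs_minus_commute) (simp only: abs_of_pos d)
      moreover have "(real m - real n) * \<theta> = - ((real n - real m) * \<theta>)" by (simp add: left_diff_distrib)
      ultimately show ?thesis by simp
    qed
    then have "cos ((real m - real n) * \<theta>) = 0" 
      by (elim disjE) (simp_all only: cos_minus cos_pi_half)
    then have "Re ?\<kappa> = 0" unfolding k by (simp only: cis.sel)
    then show ?thesis by (metis one_complex.sel(1) zero_neq_one)
  qed
  let ?M = "gauss_measure \<nu> :: (complex \<times> complex) measure"
  let ?f = "\<lambda>p. \<phi> (norm p) *\<^sub>R (e_fun m p * cnj (e_fun n p))"
  let ?T = "\<lambda>p::complex \<times> complex. (c * fst p, c * snd p)"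
  have nrm: "norm (?T p) = norm p" for p
    using c(1) by (simp add: norm_prod_def norm_mult)
  have e: "e_fun k (?T p) = c ^ k * e_fun k p" for k p
    by (simp add: e_fun_eq power_mult_distrib[symmetric] algebra_simps)
  have [measurable]: "?T \<in> borel_measurable borel"
    by (intro borel_measurable_continuous_onI continuous_intros)
  have "integral\<^sup>L ?M ?f = integral\<^sup>L (distr ?M borel ?T) ?f"
    unfolding gauss_measure_rotate[OF c] ..
  also have "\<dots> = (\<integral>p. ?f (?T p) \<partial>?M)"
  proof (rule integral_distr)
    show "?T \<in> measurable ?M borel" by simp
    show "?f \<in> borel_measurable borel"
      by (intro borel_measurable_scaleR measurable_compose[OF borel_measurable_norm] assms
            borel_measurable_continuous_onI continuous_intros)
  qed
  also have "\<dots> = (\<integral>p. ?\<kappa> * ?f p \<partial>?M)"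
    unfolding nrm e by (simp only: scaleR_conv_of_real complex_cnj_mult complex_cnj_power mult_ac)
  \<comment> \<open>For a nonintegrable integrand both integrals are 0 by convention, and the
    equation persists.\<close>
  also have "\<dots> = ?\<kappa> * integral\<^sup>L ?M ?f" by (rule integral_mult_right_zero)
  finally have "(1 - ?\<kappa>) * integral\<^sup>L ?M ?f = 0" by (simp add: algebra_simps)
  then show ?thesis using \<kappa> by simp
qed

lemma norm_fst_i_snd_le:
  fixes p :: "complex \<times> complex"
  shows "norm (fst p + \<i> * snd p) \<le> 2 * norm p"
proof -
  have "norm (fst p + \<i> * snd p) \<le> norm (fst p) + norm (\<i> * snd p)" by (rule norm_triangle_ineq)
  also have "\<dots> \<le> norm p + norm p"
    using norm_fst_le[of "fst p" "snd p"] norm_snd_le[of "snd p" "fst p"]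
    by (intro add_mono) (auto simp: norm_mult)
  finally show ?thesis by simp
qed

lemma scaled_norm_sum_sq:
  fixes a e :: "nat \<Rightarrow> complex"
  shows "complex_of_real (r * (norm (\<Sum>n\<in>A. a n * e n))\<^sup>2) = 
    (\<Sum>m\<in>A. \<Sum>n\<in>A. a m * cnj (a n) * (r *\<^sub>R (e m * cnj (e n))))"
proof -
  have 1: "of_real r * (a m * e m * cnj (a n * e n)) = a m * cnj (a n) * (r *\<^sub>R (e m * cnj (e n)))" for m n
    by (simp add: scaleR_conv_of_real)
  have "complex_of_real (r * (norm (\<Sum>n\<in>A. a n * e n))\<^sup>2) = 
    of_real r * (\<Sum>m\<in>A. \<Sum>n\<in>A. a m * e m * cnj (a n * e n))"
    unfolding of_real_mult complex_norm_square cnj_sum sum_product ..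
  then show ?thesis unfolding sum_distrib_left 1 .
qed

lemma power_series_parseval_cball:
  fixes g :: "complex \<Rightarrow> complex"
  assumes g: "\<And>u. (\<lambda>n. a n * u ^ n) sums g u"
  shows "(\<lambda>n. (norm (a n))\<^sup>2 * 
      (\<integral>p. indicator (cball 0 R) p * (norm (e_fun n p))\<^sup>2 \<partial>gauss_measure \<nu>)) 
    sums (\<integral>p. indicator (cball 0 R) p * (norm (g (fst p + \<i> * snd p)))\<^sup>2 \<partial>gauss_measure \<nu>)"
proof -
  let ?M = "gauss_measure \<nu> :: (complex \<times> complex) measure"
  let ?i = "\<lambda>p::complex \<times> complex. indicator (cball 0 R) p :: real"
  let ?S = "\<lambda>k p. \<Sum>n<k. a n * e_fun n p"
  have ind: "?i p = indicator {..R} (norm p)" for p by (auto simp: indicator_def)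
  have intg: "integrable ?M (\<lambda>p. ?i p *\<^sub>R (e_fun m p * cnj (e_fun n p)))" for m n
    by (intro integrable_gauss_measure_cball continuous_intros)
  have orth: "(\<integral>p. ?i p *\<^sub>R (e_fun m p * cnj (e_fun n p)) \<partial>?M) = 0" if "m \<noteq> n" for m n
    unfolding ind by (rule integral_e_fun_orthogonal) (use that in auto)
  have diag: "(\<integral>p. ?i p *\<^sub>R (e_fun n p * cnj (e_fun n p)) \<partial>?M)
    = complex_of_real (\<integral>p. ?i p * (norm (e_fun n p))\<^sup>2 \<partial>?M)" for n
    unfolding integral_complex_of_real[symmetric]
    by (simp only: scaleR_conv_of_real of_real_mult complex_norm_square)
  \<comment> \<open>Pythagoras on the ball: the square is expanded into a double sum, of which
    integration keeps the diagonal.\<close>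
  have fin: "(\<integral>p. ?i p * (norm (?S k p))\<^sup>2 \<partial>?M) = 
    (\<Sum>n<k. (norm (a n))\<^sup>2 * (\<integral>p. ?i p * (norm (e_fun n p))\<^sup>2 \<partial>?M))" for k
  proof -
    have "complex_of_real (\<integral>p. ?i p * (norm (?S k p))\<^sup>2 \<partial>?M) = 
       (\<integral>p. (\<Sum>m<k. \<Sum>n<k. a m * cnj (a n) * (?i p *\<^sub>R (e_fun m p * cnj (e_fun n p)))) \<partial>?M)"
      unfolding integral_complex_of_real[symmetric] by (simp only: scaled_norm_sum_sq)
    also have "\<dots> = (\<Sum>m<k. \<Sum>n<k. a m * cnj (a n) * 
        (\<integral>p. ?i p *\<^sub>R (e_fun m p * cnj (e_fun n p)) \<partial>?M))"
      by (simp only: Bochner_Integration.integral_sum Bochner_Integration.integrable_sum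
           integrable_mult_right intg integral_mult_right_zero)
    also have "\<dots> = (\<Sum>m<k. \<Sum>n<k. if m = n then 
        a m * cnj (a m) * (\<integral>p. ?i p *\<^sub>R (e_fun m p * cnj (e_fun m p)) \<partial>?M) else 0)"
      using orth by (intro sum.cong) auto
    also have "\<dots> = (\<Sum>m<k. a m * cnj (a m) * (\<integral>p. ?i p *\<^sub>R (e_fun m p * cnj (e_fun m p)) \<partial>?M))"
      by (simp add: sum.delta)
    also have "\<dots> = complex_of_real 
        (\<Sum>n<k. (norm (a n))\<^sup>2 * (\<integral>p. ?i p * (norm (e_fun n p))\<^sup>2 \<partial>?M))"
      unfolding diag of_real_sum of_real_mult complex_norm_square ..
    finally show ?thesis by (simp only: of_real_eq_iff)
  qed
  \<comment> \<open>On the ball the modulus of z + \<i> w is at most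
    \<open>2 * \<bar>R\<bar>\<close> by \<open>norm_fst_i_snd_le\<close>. Convergence at the larger
    point \<open>2 * \<bar>R\<bar> + 1\<close> makes the series absolutely convergent there, so
    \<open>C\<close> bounds all partial sums and \<open>C^2\<close> dominates on the ball.\<close>
  define C where "C = (\<Sum>n. norm (a n * of_real (2 * \<bar>R\<bar>) ^ n))"
  have summ: "summable (\<lambda>n. norm (a n * of_real (2 * \<bar>R\<bar>) ^ n))"
    by (rule powser_insidea[OF sums_summable[OF g[of "of_real (2 * \<bar>R\<bar> + 1)"]]]) (unfold norm_of_real, linarith)
  have bnd: "norm (?S k p) \<le> C" if "norm p \<le> R" for k p
  proof -
    have "norm (?S k p) \<le> (\<Sum>n<k. norm (a n * of_real (2 * \<bar>R\<bar>) ^ n))"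
    proof (rule sum_norm_le)
      fix n
      have "norm (fst p + \<i> * snd p) \<le> 2 * \<bar>R\<bar>" using norm_fst_i_snd_le[of p] that by linarith
      then have "norm (e_fun n p) \<le> (2 * \<bar>R\<bar>) ^ n"
        unfolding e_fun_eq norm_power by (intro power_mono) auto
      then show "norm (a n * e_fun n p) \<le> norm (a n * of_real (2 * \<bar>R\<bar>) ^ n)"
        by (simp add: norm_mult norm_power mult_left_mono)
    qed
    also have "\<dots> \<le> C" unfolding C_def by (intro sum_le_suminf summ) auto
    finally show ?thesis .
  qed
  have lim: "(\<lambda>k. ?S k p) \<longlonglongrightarrow> g (fst p + \<i> * snd p)" for p
    using g[of "fst p + \<i> * snd p"] unfolding sums_def e_fun_eq .
  have S_meas [measurable]: "?S k \<in> borel_measurable borel" for k by measurable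
  have g_meas [measurable]: "(\<lambda>p. g (fst p + \<i> * snd p)) \<in> borel_measurable borel"
    by (rule borel_measurable_LIMSEQ_metric[OF S_meas lim])
  have meas: "(\<lambda>p. ?i p * (norm (f p))\<^sup>2) \<in> borel_measurable ?M" 
    if [measurable]: "f \<in> borel_measurable borel" for f :: "complex \<times> complex \<Rightarrow> complex"
    by (intro borel_measurable_times borel_measurable_indicator) auto
  have "(\<lambda>k. \<integral>p. ?i p * (norm (?S k p))\<^sup>2 \<partial>?M) \<longlonglongrightarrow> 
      (\<integral>p. ?i p * (norm (g (fst p + \<i> * snd p)))\<^sup>2 \<partial>?M)"
  proof (rule integral_dominated_convergence)
    show "integrable ?M (\<lambda>p. ?i p *\<^sub>R C\<^sup>2)" by (rule integrable_gauss_measure_cball) auto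
    show "AE p in ?M. (\<lambda>k. ?i p * (norm (?S k p))\<^sup>2) \<longlonglongrightarrow> ?i p * (norm (g (fst p + \<i> * snd p)))\<^sup>2"
      by (intro AE_I2 tendsto_intros lim)
    show "AE p in ?M. norm (?i p * (norm (?S k p))\<^sup>2) \<le> ?i p *\<^sub>R C\<^sup>2" for k
      using bnd by (intro AE_I2) (auto simp: indicator_def intro!: power_mono)
  qed (intro meas g_meas S_meas)+
  then show ?thesis unfolding fin sums_def .
qed

lemma powser_entire:
  fixes g :: "complex \<Rightarrow> complex"
  assumes g: "\<And>u. (\<lambda>n. a n * u ^ n) sums g u"
  shows "g holomorphic_on UNIV"
proof -
  have "g holomorphic_on ball 0 r" for r
    by (rule power_series_holomorphic[where a = a]) (use g in auto)
  then have "g field_differentiable at z" for z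
    by (rule holomorphic_on_imp_differentiable_at[of g "ball 0 (norm z + 1)"]) auto
  then show ?thesis
    by (auto simp: holomorphic_on_def field_differentiable_at_within)
qed

lemma power_series_parseval:
  fixes g :: "complex \<Rightarrow> complex"
  assumes g: "\<And>u. (\<lambda>n. a n * u ^ n) sums g u"
  shows "(\<integral>\<^sup>+p. ennreal ((norm (g (fst p + \<i> * snd p)))\<^sup>2) \<partial>gauss_measure \<nu>) = 
    (\<Sum>n. ennreal ((norm (a n))\<^sup>2) * (\<integral>\<^sup>+p. ennreal ((norm (e_fun n p))\<^sup>2) \<partial>gauss_measure \<nu>))"
proof -
  let ?M = "gauss_measure \<nu> :: (complex \<times> complex) measure"
  have g_cont: "continuous_on UNIV (\<lambda>p. g (fst p + \<i> * snd p))"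
  proof -
    have "continuous_on UNIV g" 
      using powser_entire[OF g] by (rule holomorphic_on_imp_continuous_on)
    then show ?thesis
      by (rule continuous_on_compose2) (auto intro!: continuous_intros)
  qed
  have conv: "ennreal (\<integral>p. indicator (cball 0 R) p * (norm (f p))\<^sup>2 \<partial>?M) = 
     (\<integral>\<^sup>+p. ennreal ((norm (f p))\<^sup>2) * indicator (cball 0 R) p \<partial>?M)"
    if "continuous_on UNIV f" for R and f :: "complex \<times> complex \<Rightarrow> complex"
  proof -
    have "integrable ?M (\<lambda>p. indicator (cball 0 R) p *\<^sub>R (norm (f p))\<^sup>2)"
      by (intro integrable_gauss_measure_cball continuous_intros that)
    then have "ennreal (\<integral>p. indicator (cball 0 R) p * (norm (f p))\<^sup>2 \<partial>?M) = 
      (\<integral>\<^sup>+p. ennreal (indicator (cball 0 R) p * (norm (f p))\<^sup>2) \<partial>?M)"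
      by (subst nn_integral_eq_integral) auto
    also have "\<dots> = (\<integral>\<^sup>+p. ennreal ((norm (f p))\<^sup>2) * indicator (cball 0 R) p \<partial>?M)"
      by (intro nn_integral_cong) (auto simp: indicator_def)
    finally show ?thesis .
  qed
  have ball: "(\<integral>\<^sup>+p. ennreal ((norm (g (fst p + \<i> * snd p)))\<^sup>2) * indicator (cball 0 R) p \<partial>?M) = 
    (\<Sum>n. ennreal ((norm (a n))\<^sup>2) * 
      (\<integral>\<^sup>+p. ennreal ((norm (e_fun n p))\<^sup>2) * indicator (cball 0 R) p \<partial>?M))" for R
    unfolding conv[OF g_cont, symmetric] conv[OF continuous_on_e_fun[OF continuous_on_id], symmetric]
    by (subst suminf_ennreal_eq[OF _ power_series_parseval_cball[OF g], symmetric])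
       (auto simp: ennreal_mult)
  have [measurable]: "(\<lambda>p. g (fst p + \<i> * snd p)) \<in> borel_measurable borel"
    by (rule borel_measurable_continuous_onI[OF g_cont])
  have "(\<integral>\<^sup>+p. ennreal ((norm (g (fst p + \<i> * snd p)))\<^sup>2) \<partial>?M) = 
    (SUP k::nat. \<Sum>n. ennreal ((norm (a n))\<^sup>2) * 
      (\<integral>\<^sup>+p. ennreal ((norm (e_fun n p))\<^sup>2) * indicator (cball 0 (real k)) p \<partial>?M))"
    unfolding ball[symmetric] by (rule nn_integral_gauss_measure_cball_SUP[symmetric]) measurable
  \<comment> \<open>Sum and supremum may be exchanged because every term increases with the
    radius.\<close>
  also have "\<dots> = (\<Sum>n. SUP k::nat. ennreal ((norm (a n))\<^sup>2) * 
      (\<integral>\<^sup>+p. ennreal ((norm (e_fun n p))\<^sup>2) * indicator (cball 0 (real k)) p \<partial>?M))"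
    by (rule ennreal_suminf_SUP_eq[symmetric])
       (auto simp: incseq_def indicator_def intro!: mult_left_mono nn_integral_mono)
  also have "\<dots> = (\<Sum>n. ennreal ((norm (a n))\<^sup>2) * (\<integral>\<^sup>+p. ennreal ((norm (e_fun n p))\<^sup>2) \<partial>?M))"
    unfolding SUP_mult_left_ennreal[symmetric]
    by (subst nn_integral_gauss_measure_cball_SUP) auto
  finally show ?thesis .
qed

section \<open>Gaussian integrals and the norms of \<open>e_fun\<close>\<close>

lemma nn_integral_exp_linear_gauss:
  fixes d \<nu> :: real
  assumes \<nu>: "\<nu> > 0"
  shows "(\<integral>\<^sup>+x. ennreal (exp (2 * d * x - \<nu> * x\<^sup>2)) \<partial>lborel) = ennreal (sqrt (pi / \<nu>) * exp (d\<^sup>2 / \<nu>))"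
proof -
  \<comment> \<open>Completing the square gives a constant times the normal density with mean
    \<open>d / \<nu>\<close> and variance \<open>1 / (2 * \<nu>)\<close>.\<close>
  define \<sigma> where "\<sigma> = 1 / sqrt (2 * \<nu>)"
  have \<sigma>: "\<sigma> > 0" "\<sigma>\<^sup>2 = 1 / (2 * \<nu>)" using \<nu> by (auto simp: \<sigma>_def power_divide)
  have eq: "exp (2 * d * x - \<nu> * x\<^sup>2) = sqrt (pi / \<nu>) * exp (d\<^sup>2 / \<nu>) * normal_density (d / \<nu>) \<sigma> x" for x
  proof -
    have "2 * d * x - \<nu> * x\<^sup>2 = d\<^sup>2 / \<nu> + - (x - d / \<nu>)\<^sup>2 / (2 * \<sigma>\<^sup>2)"
      using \<nu> unfolding \<sigma>(2) by (simp add: field_simps power2_eq_square)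
    then have "exp (2 * d * x - \<nu> * x\<^sup>2) = exp (d\<^sup>2 / \<nu>) * exp (- (x - d / \<nu>)\<^sup>2 / (2 * \<sigma>\<^sup>2))"
      by (simp only: exp_add)
    moreover have "sqrt (pi / \<nu>) * (1 / sqrt (2 * pi * \<sigma>\<^sup>2)) = 1"
      using \<nu> unfolding \<sigma>(2) by simp
    then have "sqrt (pi / \<nu>) * A * (1 / sqrt (2 * pi * \<sigma>\<^sup>2) * B) = A * B" for A B :: real
      by (metis (no_types, opaque_lifting) mult.assoc mult.commute mult_1)
    ultimately show ?thesis unfolding normal_density_def by simp
  qed
  have "(\<integral>\<^sup>+x. ennreal (normal_density (d / \<nu>) \<sigma> x) \<partial>lborel) = 1"
    using \<sigma> by (subst nn_integral_eq_integral) auto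
  then show ?thesis
    unfolding eq using \<nu> by (simp add: ennreal_mult nn_integral_cmult mult.assoc)
qed

text \<open>Weight and exponential both factor over the coordinates, which leaves one-dimensional
  integrals. The case \<open>v = 0\<close> is the total mass.\<close>

lemma nn_integral_exp_linear_gauss_measure:
  fixes v :: "'a::euclidean_space"
  assumes \<nu>: "\<nu> > 0"
  shows "(\<integral>\<^sup>+p. ennreal (exp (2 * (v \<bullet> p))) \<partial>gauss_measure \<nu>) = 
    ennreal (sqrt (pi / \<nu>) ^ DIM('a) * exp ((norm v)\<^sup>2 / \<nu>))"
proof -
  have "(\<integral>\<^sup>+p. ennreal (exp (2 * (v \<bullet> p))) \<partial>gauss_measure \<nu>) =
    (\<integral>\<^sup>+p. (\<Prod>b\<in>Basis. ennreal (exp (2 * (v \<bullet> b) * ((p::'a) \<bullet> b) - \<nu> * (p \<bullet> b)\<^sup>2))) \<partial>lborel)"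
  proof (subst nn_integral_gauss_measure, measurable, intro nn_integral_cong)
    fix p :: 'a
    have "exp (- \<nu> * (norm p)\<^sup>2) * exp (2 * (v \<bullet> p)) = 
       exp (\<Sum>b\<in>Basis. 2 * (v \<bullet> b) * (p \<bullet> b) - \<nu> * (p \<bullet> b)\<^sup>2)"
      unfolding exp_add[symmetric] power2_norm_eq_inner
      by (subst (1 2) euclidean_inner)
         (simp add: sum_subtractf sum_negf sum_distrib_left power2_eq_square mult.assoc)
    then show "ennreal (exp (- \<nu> * (norm p)\<^sup>2)) * ennreal (exp (2 * (v \<bullet> p))) = 
       (\<Prod>b\<in>Basis. ennreal (exp (2 * (v \<bullet> b) * (p \<bullet> b) - \<nu> * (p \<bullet> b)\<^sup>2)))"
      by (simp add: prod_ennreal exp_sum ennreal_mult[symmetric])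
  qed
  also have "\<dots> = (\<Prod>b\<in>Basis. \<integral>\<^sup>+x. ennreal (exp (2 * (v \<bullet> b) * x - \<nu> * x\<^sup>2)) \<partial>lborel)"
    by (rule nn_integral_lborel_prod[where f = "\<lambda>b x. ennreal (exp (2 * (v \<bullet> b) * x - \<nu> * x\<^sup>2))"]) auto
  also have "\<dots> = ennreal (\<Prod>b\<in>Basis. sqrt (pi / \<nu>) * exp ((v \<bullet> b)\<^sup>2 / \<nu>))"
    unfolding nn_integral_exp_linear_gauss[OF \<nu>] using \<nu> by (intro prod_ennreal) auto
  also have "(\<Prod>b\<in>Basis. sqrt (pi / \<nu>) * exp ((v \<bullet> b)\<^sup>2 / \<nu>)) = 
     sqrt (pi / \<nu>) ^ DIM('a) * exp ((norm v)\<^sup>2 / \<nu>)"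
    unfolding power2_norm_eq_inner
    by (subst euclidean_inner) 
       (simp add: prod.distrib exp_sum sum_divide_distrib power2_eq_square)
  finally show ?thesis .
qed

text \<open>Zeros of a nonzero power series are isolated, so agreement on a half-line suffices. In
  the application \<open>t\<close> is the square of a real parameter.\<close>

lemma nonneg_powser_eqD:
  fixes a b :: "nat \<Rightarrow> real"
  assumes a: "\<And>t. t \<ge> 0 \<Longrightarrow> (\<lambda>n. a n * t ^ n) sums f t" and b: "\<And>t. t \<ge> 0 \<Longrightarrow> (\<lambda>n. b n * t ^ n) sums f t"
  shows "a = b"
proof (rule ccontr)
  assume "a \<noteq> b"
  then obtain m where m: "a m - b m \<noteq> 0" by (auto simp: fun_eq_iff)
  define d where "d n = a n - b n" for n
  define h where "h t = (\<Sum>n. d n * t ^ n)" for t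
  have d: "(\<lambda>n. d n * t ^ n) sums 0" if "t \<ge> 0" for t
    using sums_diff[OF a[OF that] b[OF that]] by (simp add: d_def algebra_simps)
  have h: "(\<lambda>n. d n * (t - 0) ^ n) sums h t" if "norm (t - 0) < 1" for t
    using powser_inside[OF sums_summable[OF d[of 1]], of t] that
    by (simp add: h_def summable_sums)
  have h0: "h t = 0" if "t \<ge> 0" for t
    using sums_unique[OF d[OF that]] by (simp add: h_def)
  \<comment> \<open>\<open>powser_0_nonzero\<close> asks for a nonzero coefficient of positive
    index.\<close>
  have "d 0 = 0" using h0[of 0] powser_zero[of d] by (simp add: h_def)
  with m have "m > 0" by (cases m) (auto simp: d_def)
  obtain s where "0 < s" "\<And>z. z \<in> cball 0 s - {0} \<Longrightarrow> h z \<noteq> 0"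
    using powser_0_nonzero[of 1 0 d h m] h h0[of 0] m \<open>m > 0\<close> by (auto simp: d_def)
  with h0[of s] show False by (auto simp: dist_norm)
qed

lemma nn_integral_norm_e_fun:
  assumes \<nu>: "\<nu> > 0"
  shows "(\<integral>\<^sup>+p. ennreal ((norm (e_fun n p))\<^sup>2) \<partial>gauss_measure \<nu>) = 
    ennreal ((pi / \<nu>)\<^sup>2 * (2 / \<nu>) ^ n * fact n)"
proof -
  let ?M = "gauss_measure \<nu> :: (complex \<times> complex) measure"
  define N where "N n = (\<integral>\<^sup>+p. ennreal ((norm (e_fun n p))\<^sup>2) \<partial>?M)" for n
  \<comment> \<open>Parseval's identity for \<open>exp (c (z + \<i> w))\<close> is a generating function for the norms.\<close>
  have gen: "(\<Sum>n. ennreal ((c ^ n / fact n)\<^sup>2) * N n) = ennreal ((pi / \<nu>)\<^sup>2 * exp (2 * c\<^sup>2 / \<nu>))" for c :: real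
  proof -
    have "(\<lambda>n. (of_real c ^ n / fact n) * u ^ n) sums exp (of_real c * u)" for u :: complex
      using exp_converges[of "of_real c * u"] 
      by (simp add: scaleR_conv_of_real power_mult_distrib field_simps)
    from power_series_parseval[OF this, of \<nu>]
    have "(\<integral>\<^sup>+p. ennreal ((norm (exp (of_real c * (fst p + \<i> * snd p))))\<^sup>2) \<partial>?M) = 
      (\<Sum>n. ennreal ((c ^ n / fact n)\<^sup>2) * N n)"
      by (simp add: N_def norm_divide norm_power power_divide power_even_abs flip: power_mult)
    \<comment> \<open>The real part of \<open>c * (z + \<i> * w)\<close> is the real inner product
      of \<open>(z, w)\<close> with \<open>(c, - \<i> * c)\<close>, a vector of squared norm
      \<open>2 * c^2\<close>.\<close>
    moreover have "(norm (exp (of_real c * (fst p + \<i> * snd p))))\<^sup>2 = exp (2 * ((of_real c, - \<i> * of_real c) \<bullet> p))" 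
      for p :: "complex \<times> complex"
    proof -
      have "norm (exp (of_real c * (fst p + \<i> * snd p))) = exp ((of_real c, - \<i> * of_real c) \<bullet> p)"
        by (cases p) (simp add: norm_exp_eq_Re inner_complex_def algebra_simps)
      then show ?thesis by (simp only: exp_double)
    qed
    ultimately have "(\<Sum>n. ennreal ((c ^ n / fact n)\<^sup>2) * N n) = 
       (\<integral>\<^sup>+p. ennreal (exp (2 * ((of_real c, - \<i> * of_real c) \<bullet> p))) \<partial>?M)"
      by simp
    also have "\<dots> = ennreal ((pi / \<nu>)\<^sup>2 * exp (2 * c\<^sup>2 / \<nu>))"
    proof -
      have "(norm (of_real c :: complex, - \<i> * of_real c))\<^sup>2 = 2 * c\<^sup>2"
        by (simp add: norm_prod_def norm_mult)
      moreover have "sqrt (pi / \<nu>) ^ DIM(complex \<times> complex) = (pi / \<nu>)\<^sup>2"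
      proof -
        have "sqrt (pi / \<nu>) ^ DIM(complex \<times> complex) = ((sqrt (pi / \<nu>))\<^sup>2)\<^sup>2"
          by (simp flip: power_mult)
        also have "(sqrt (pi / \<nu>))\<^sup>2 = pi / \<nu>" using \<nu> by simp
        finally show ?thesis .
      qed
      ultimately show ?thesis by (simp only: nn_integral_exp_linear_gauss_measure[OF \<nu>])
    qed
    finally show ?thesis .
  qed
  \<comment> \<open>At \<open>c = 1\<close> the sum is finite, hence so is each term, and the factor
    of \<open>N n\<close> in it is positive.\<close>
  have fin: "N n < top" for n
  proof -
    have "ennreal ((1 ^ n / fact n)\<^sup>2) * N n < top"
      by (rule ennreal_suminf_lessD) (subst gen, simp)
    then show ?thesis by (auto simp: ennreal_mult_less_top)
  qed
  define r where "r n = enn2real (N n)" for n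
  have Nr: "N n = ennreal (r n)" "r n \<ge> 0" for n using fin[of n] by (auto simp: r_def)
  \<comment> \<open>The substitution \<open>t = c^2\<close> gives a real power series, to be matched
    with the exponential series.\<close>
  have a: "(\<lambda>n. (r n / (fact n)\<^sup>2) * t ^ n) sums ((pi / \<nu>)\<^sup>2 * exp (2 * t / \<nu>))" if "t \<ge> 0" for t
  proof -
    have "ennreal ((sqrt t ^ n / fact n)\<^sup>2) * N n = ennreal ((r n / (fact n)\<^sup>2) * t ^ n)" for n
    proof -
      have "(sqrt t ^ n)\<^sup>2 = ((sqrt t)\<^sup>2) ^ n" by (simp only: power_mult[symmetric] mult.commute)
      then have "(sqrt t ^ n)\<^sup>2 = t ^ n" using that by simp
      then show ?thesis using Nr[of n] that by (simp add: ennreal_mult[symmetric] power_divide mult.commute)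
    qed
    then have "(\<Sum>n. ennreal ((r n / (fact n)\<^sup>2) * t ^ n)) = ennreal ((pi / \<nu>)\<^sup>2 * exp (2 * t / \<nu>))"
      using gen[of "sqrt t"] that by simp
    moreover have "(\<lambda>n. ennreal ((r n / (fact n)\<^sup>2) * t ^ n)) sums (\<Sum>n. ennreal ((r n / (fact n)\<^sup>2) * t ^ n))"
      by (rule summable_sums[OF summableI])
    ultimately have "(\<lambda>n. ennreal ((r n / (fact n)\<^sup>2) * t ^ n)) sums ennreal ((pi / \<nu>)\<^sup>2 * exp (2 * t / \<nu>))"
      by simp
    then show ?thesis by (rule sums_ennreal[THEN iffD1, rotated 2]) (use Nr that in auto)
  qed
  have b: "(\<lambda>n. ((pi / \<nu>)\<^sup>2 * (2 / \<nu>) ^ n / fact n) * t ^ n) sums ((pi / \<nu>)\<^sup>2 * exp (2 * t / \<nu>))" for t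
    using sums_mult[OF exp_converges[of "2 * t / \<nu>"], of "(pi / \<nu>)\<^sup>2"]
    by (simp add: power_divide power_mult_distrib field_simps)
  have "(\<lambda>n. r n / (fact n)\<^sup>2) = (\<lambda>n. (pi / \<nu>)\<^sup>2 * (2 / \<nu>) ^ n / fact n)"
    by (rule nonneg_powser_eqD[OF a b])
  then have "r n / (fact n)\<^sup>2 = (pi / \<nu>)\<^sup>2 * (2 / \<nu>) ^ n / fact n" by (rule fun_cong)
  then have "r n = (pi / \<nu>)\<^sup>2 * (2 / \<nu>) ^ n * fact n" by (simp add: power2_eq_square field_simps)
  with Nr[of n] show ?thesis by (simp add: N_def)
qed

subsection \<open>The space \<open>A_space\<close>\<close>

text \<open>Serves the two coordinate directions and the direction \<open>(- \<i>, 1)\<close>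
  alike.\<close>

lemma holomorphic2_along_line:
  assumes "(F has_derivative D) (at (a + \<zeta> * b, c + \<zeta> * d))"
    and "\<And>c z w. D (c * z, c * w) = c * D (z, w)"
  shows "((\<lambda>\<zeta>. F (a + \<zeta> * b, c + \<zeta> * d)) has_field_derivative D (b, d)) (at \<zeta>)"
proof -
  have "((\<lambda>\<zeta>. (a + \<zeta> * b, c + \<zeta> * d)) has_derivative (\<lambda>h. (h * b, h * d))) (at \<zeta>)"
    by (auto intro!: derivative_eq_intros)
  from diff_chain_at[OF this assms(1)] show ?thesis
    by (simp add: has_field_derivative_def o_def assms(2) mult_commute_abs)
qed

lemma holomorphic2E:
  assumes "holomorphic2 F"
  obtains D where "\<And>p. (F has_derivative D p) (at p)" "\<And>p c z w. D p (c * z, c * w) = c * D p (z, w)"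
proof -
  have "\<forall>p. \<exists>D. (F has_derivative D) (at p) \<and> (\<forall>c z w. D (c * z, c * w) = c * D (z, w))"
    using assms by (simp add: holomorphic2_def)
  from choice[OF this] show thesis using that by blast
qed

lemma holomorphic2_restrict_fst:
  assumes "holomorphic2 F"
  shows "(\<lambda>\<zeta>. F (\<zeta>, w)) holomorphic_on UNIV"
proof -
  obtain D where D: "\<And>p. (F has_derivative D p) (at p)" 
    and lin: "\<And>p c z w. D p (c * z, c * w) = c * D p (z, w)"
    using holomorphic2E[OF assms] by blast
  have "((\<lambda>\<zeta>. F (\<zeta>, w)) has_field_derivative D (z, w) (1, 0)) (at z)" for z
    using holomorphic2_along_line[OF D lin, where a = 0 and \<zeta> = z and b = 1 and c = w and d = 0] by simp
  then show ?thesis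
    by (intro holomorphic_onI) (auto simp: field_differentiable_def intro: has_field_derivative_at_within)
qed

lemma A_space_iff:
  "F \<in> A_space \<nu> \<longleftrightarrow> F \<in> l2_space (gauss_measure \<nu>) \<and> 
    (\<exists>g. g holomorphic_on UNIV \<and> F = (\<lambda>p. g (fst p + \<i> * snd p)))"
proof (intro iffI conjI; (elim conjE exE)?)
  assume F: "F \<in> A_space \<nu>"
  then show "F \<in> l2_space (gauss_measure \<nu>)" by (simp add: A_space_def fock_space_def)
  obtain D where D: "\<And>p. (F has_derivative D p) (at p)" 
    and lin: "\<And>p c z w. D p (c * z, c * w) = c * D p (z, w)"
    using F holomorphic2E unfolding A_space_def fock_space_def by blast
  note line = holomorphic2_along_line[OF D lin]
  have dz: "((\<lambda>\<zeta>. F (\<zeta>, w)) has_field_derivative D (z, w) (1, 0)) (at z)" for z w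
    using line[where a = 0 and \<zeta> = z and b = 1 and c = w and d = 0] by simp
  have dw: "((\<lambda>\<omega>. F (z, \<omega>)) has_field_derivative D (z, w) (0, 1)) (at w)" for z w
    using line[where a = z and \<zeta> = w and b = 0 and c = 0 and d = 1] by simp
  have CR: "D (z, w) (1, 0) + \<i> * D (z, w) (0, 1) = 0" for z w
    using F DERIV_imp_deriv[OF dz] DERIV_imp_deriv[OF dw] by (auto simp: A_space_def)
  \<comment> \<open>By complex linearity, the derivative along \<open>(- \<i>, 1)\<close> is
    \<open>- \<i>\<close> times the left side of the differential equation.\<close>
  have zero: "D p (- \<i>, 1) = 0" for p
  proof -
    interpret linear "D p" using D by (rule has_derivative_linear)
    have "D p (- \<i>, 1) = D p (- \<i> * 1, - \<i> * 0) + D p (0, 1)" by (simp add: add[symmetric])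
    also have "\<dots> = - \<i> * (D p (1, 0) + \<i> * D p (0, 1))" unfolding lin by (simp add: algebra_simps)
    also have "\<dots> = 0" using CR[of "fst p" "snd p"] by simp
    finally show ?thesis .
  qed
  \<comment> \<open>The complex line through \<open>(z + \<i> * w, 0)\<close> with direction
    \<open>(- \<i>, 1)\<close> reaches \<open>(z, w)\<close> at parameter \<zeta> = w. So the entire
    function sought is the restriction of \<open>F\<close> to second coordinate 0.\<close>
  have const: "F (z, w) = F (z + \<i> * w, 0)" for z w
  proof -
    have "\<exists>k. \<forall>\<zeta>\<in>UNIV. F (z + \<i> * w + \<zeta> * (- \<i>), 0 + \<zeta> * 1) = k"
      by (rule has_field_derivative_zero_constant) 
         (use line[where a = "z + \<i> * w" and b = "- \<i>" and c = 0 and d = 1, unfolded zero] in auto)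
    then obtain k where k: "\<And>\<zeta>. F (z + \<i> * w + \<zeta> * (- \<i>), 0 + \<zeta> * 1) = k" by blast
    show ?thesis using k[of 0] k[of w] by (simp add: mult.commute)
  qed
  have "(\<lambda>\<zeta>. F (\<zeta>, 0)) holomorphic_on UNIV"
    using F by (intro holomorphic2_restrict_fst) (simp add: A_space_def fock_space_def)
  then show "\<exists>g. g holomorphic_on UNIV \<and> F = (\<lambda>p. g (fst p + \<i> * snd p))"
    using const by (intro exI[of _ "\<lambda>\<zeta>. F (\<zeta>, 0)"]) (auto simp: fun_eq_iff)
next
  fix g assume l2: "F \<in> l2_space (gauss_measure \<nu>)" and g: "g holomorphic_on UNIV" 
    and F: "F = (\<lambda>p. g (fst p + \<i> * snd p))"
  have dg: "(g has_field_derivative deriv g z) (at z)" for z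
    using g by (auto intro: holomorphic_derivI)
  have "(F has_derivative (\<lambda>v. deriv g (fst p + \<i> * snd p) * (fst v + \<i> * snd v))) (at p)" for p
    unfolding F
    by (rule has_derivative_compose[OF _ dg[unfolded has_field_derivative_def], 
          of "\<lambda>p. fst p + \<i> * snd p"]) (auto intro!: derivative_eq_intros)
  then have "holomorphic2 F"
    unfolding holomorphic2_def by (fastforce simp: algebra_simps)
  moreover have "deriv (\<lambda>\<zeta>. F (\<zeta>, w)) z = deriv g (z + \<i> * w)" for z w
  proof -
    have "((\<lambda>\<zeta>. \<zeta> + \<i> * w) has_field_derivative 1) (at z)" by (auto intro!: derivative_eq_intros)
    from DERIV_chain'[OF this dg] show ?thesis by (simp add: F DERIV_imp_deriv)
  qed
  moreover have "deriv (\<lambda>\<omega>. F (z, \<omega>)) w = deriv g (z + \<i> * w) * \<i>" for z w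
  proof -
    have "((\<lambda>\<omega>. z + \<i> * \<omega>) has_field_derivative \<i>) (at w)" by (auto intro!: derivative_eq_intros)
    from DERIV_chain'[OF this dg] show ?thesis by (simp add: F DERIV_imp_deriv)
  qed
  moreover have "a + \<i> * (a * \<i>) = 0" for a by (simp add: complex_eq_iff)
  ultimately show "F \<in> A_space \<nu>"
    using l2 by (simp add: A_space_def fock_space_def)
qed

section \<open>Closedness of \<open>A_space\<close>\<close>

lemma A_space_shift:
  assumes "F \<in> A_space \<nu>" and q: "fst q + \<i> * snd q = 0"
  shows "F (q + p) = F p"
proof -
  obtain g where F: "F = (\<lambda>p. g (fst p + \<i> * snd p))"
    using assms(1) by (auto simp: A_space_iff)
  have "fst q + fst p + \<i> * (snd q + snd p) = fst q + \<i> * snd q + (fst p + \<i> * snd p)"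
    by (simp add: algebra_simps)
  then show ?thesis by (simp only: F fst_add snd_add q add_0)
qed

text \<open>For \<open>q \<noteq> 0\<close> the quotient of the weight and its translate is
  unbounded. Since \<open>(norm (q + p))^2 \<le> 2 * (norm q)^2 + 2 * (norm p)^2\<close>, doubling
  the exponent restores a bound.\<close>

lemma l2_space_gauss_shift:
  fixes f :: "'a::euclidean_space \<Rightarrow> complex"
  assumes f: "f \<in> l2_space (gauss_measure \<nu>)" and \<nu>: "\<nu> > 0"
  shows "(\<lambda>p. f (q + p)) \<in> l2_space (gauss_measure (2 * \<nu>))"
    and "l2_norm (gauss_measure (2 * \<nu>)) (\<lambda>p. f (q + p)) \<le> exp (\<nu> * (norm q)\<^sup>2) * l2_norm (gauss_measure \<nu>) f"
proof -
  have [measurable]: "f \<in> borel_measurable borel" using f by (simp add: l2_space_def)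
  let ?h = "\<lambda>p. exp (- \<nu> * (norm p)\<^sup>2) * (norm (f p))\<^sup>2"
  have h: "integrable lborel ?h" 
    using f by (simp add: l2_space_def integrable_gauss_measure)
  have meas_h [measurable]: "?h \<in> borel_measurable borel" by measurable
  have inv: "distr lborel borel ((+) q) = (lborel :: 'a measure)"
    by (rule lborel_distr_plus)
  have h': "integrable lborel (\<lambda>p. ?h (q + p))"
    using h by (subst (asm) inv[symmetric], subst (asm) integrable_distr_eq) auto
  have int_h': "(\<integral>p. ?h (q + p) \<partial>lborel) = (\<integral>p. ?h p \<partial>lborel)"
    by (subst (2) inv[symmetric], subst integral_distr) auto
  have le: "exp (- (2 * \<nu>) * (norm p)\<^sup>2) * (norm (f (q + p)))\<^sup>2 \<le> exp (2 * \<nu> * (norm q)\<^sup>2) * ?h (q + p)" for p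
  proof -
    have "(norm (q + p))\<^sup>2 \<le> (norm q + norm p)\<^sup>2" by (intro power_mono norm_triangle_ineq) auto
    also have "\<dots> \<le> 2 * (norm q)\<^sup>2 + 2 * (norm p)\<^sup>2"
      using zero_le_power2[of "norm q - norm p"] by (simp add: power2_eq_square algebra_simps)
    finally have "\<nu> * (norm (q + p))\<^sup>2 \<le> \<nu> * (2 * (norm q)\<^sup>2 + 2 * (norm p)\<^sup>2)"
      using \<nu> by (intro mult_left_mono) auto
    then have "exp (- (2 * \<nu>) * (norm p)\<^sup>2) \<le> exp (2 * \<nu> * (norm q)\<^sup>2 + - \<nu> * (norm (q + p))\<^sup>2)"
      unfolding exp_le_cancel_iff by (simp add: algebra_simps)
    then have "exp (- (2 * \<nu>) * (norm p)\<^sup>2) \<le> exp (2 * \<nu> * (norm q)\<^sup>2) * exp (- \<nu> * (norm (q + p))\<^sup>2)"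
      by (simp only: exp_add)
    then show ?thesis unfolding mult.assoc[symmetric] by (rule mult_right_mono) simp
  qed
  have int: "integrable lborel (\<lambda>p. exp (- (2 * \<nu>) * (norm p)\<^sup>2) * (norm (f (q + p)))\<^sup>2)"
    by (rule Bochner_Integration.integrable_bound[OF integrable_mult_right[OF h', of "exp (2 * \<nu> * (norm q)\<^sup>2)"]])
       (measurable, use le in auto)
  then show "(\<lambda>p. f (q + p)) \<in> l2_space (gauss_measure (2 * \<nu>))"
    by (simp add: l2_space_def integrable_gauss_measure)
  have "(\<integral>p. exp (- (2 * \<nu>) * (norm p)\<^sup>2) * (norm (f (q + p)))\<^sup>2 \<partial>lborel) \<le> 
     (\<integral>p. exp (2 * \<nu> * (norm q)\<^sup>2) * ?h (q + p) \<partial>lborel)"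
    by (intro integral_mono int integrable_mult_right h' le)
  also have "\<dots> = exp (2 * \<nu> * (norm q)\<^sup>2) * (\<integral>p. ?h p \<partial>lborel)" using int_h' by simp
  also have "exp (2 * \<nu> * (norm q)\<^sup>2) = (exp (\<nu> * (norm q)\<^sup>2))\<^sup>2" by (simp add: exp_double[symmetric] mult.assoc)
  finally have "sqrt (\<integral>p. exp (- (2 * \<nu>) * (norm p)\<^sup>2) * (norm (f (q + p)))\<^sup>2 \<partial>lborel) \<le> 
      sqrt ((exp (\<nu> * (norm q)\<^sup>2))\<^sup>2 * (\<integral>p. ?h p \<partial>lborel))"
    by (rule real_sqrt_le_mono)
  then show "l2_norm (gauss_measure (2 * \<nu>)) (\<lambda>p. f (q + p)) \<le> exp (\<nu> * (norm q)\<^sup>2) * l2_norm (gauss_measure \<nu>) f"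
    by (simp add: l2_norm_eq integral_gauss_measure real_sqrt_mult)
qed

lemma subspace_A_space: "cfun.subspace (A_space \<nu>)"
  unfolding cfun.subspace_def
proof (intro conjI ballI allI)
  show "0 \<in> A_space \<nu>"
    unfolding A_space_iff zero_fun_def by (auto simp: l2_space_def intro!: exI[of _ "\<lambda>_. 0"])
next
  fix F G assume "F \<in> A_space \<nu>" "G \<in> A_space \<nu>"
  then obtain f g where "F \<in> l2_space (gauss_measure \<nu>)" "G \<in> l2_space (gauss_measure \<nu>)" 
    "f holomorphic_on UNIV" "g holomorphic_on UNIV" 
    "F = (\<lambda>p. f (fst p + \<i> * snd p))" "G = (\<lambda>p. g (fst p + \<i> * snd p))"
    by (auto simp: A_space_iff)
  moreover from this have "F + G = (\<lambda>p. f (fst p + \<i> * snd p) + g (fst p + \<i> * snd p))"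
    by (simp add: plus_fun_def)
  ultimately show "F + G \<in> A_space \<nu>"
    unfolding A_space_iff
    by (intro conjI l2_space_add exI[of _ "\<lambda>u. f u + g u"] holomorphic_intros)
next
  fix c F assume "F \<in> A_space \<nu>"
  then obtain f where "F \<in> l2_space (gauss_measure \<nu>)" 
    "f holomorphic_on UNIV" "F = (\<lambda>p. f (fst p + \<i> * snd p))"
    by (auto simp: A_space_iff)
  moreover from this have "(\<lambda>x. c * F x) = (\<lambda>p. c * f (fst p + \<i> * snd p))" by simp
  ultimately show "(\<lambda>x. c * F x) \<in> A_space \<nu>"
    unfolding A_space_iff
    by (intro conjI l2_space_cmult exI[of _ "\<lambda>u. c * f u"] holomorphic_intros)
qed

lemma continuous_on_fock_space:
  assumes "F \<in> fock_space \<nu>"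
  shows "continuous_on UNIV F"
  using assms unfolding fock_space_def holomorphic2_def
  by (auto simp: continuous_on_eq_continuous_at dest!: spec intro: has_derivative_continuous)

text \<open>
  Elements of \<open>A_space\<close> are characterised by invariance under translations by \<open>(\<i> w, - w)\<close>, and
  translations are continuous from the space with weight \<open>\<nu>\<close> to the one with weight \<open>2 \<nu>\<close>.
\<close>

lemma closed_subspace_A_space:
  assumes \<nu>: "\<nu> > 0"
  shows "closed_subspace (gauss_measure \<nu>) (fock_space \<nu>) (A_space \<nu>)"
proof -
  let ?M = "gauss_measure \<nu> :: (complex \<times> complex) measure"
  let ?M2 = "gauss_measure (2 * \<nu>) :: (complex \<times> complex) measure"
  interpret Metric_space "fock_space \<nu>" "l2_dist ?M" by (rule Metric_space_fock_space)
  have sub: "A_space \<nu> \<subseteq> fock_space \<nu>" by (auto simp: A_space_def)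
  have "\<exists>r>0. disjnt (A_space \<nu>) (mball F r)" if F: "F \<in> fock_space \<nu> - A_space \<nu>" for F
  proof -
    have l2: "F \<in> l2_space ?M" using F by (simp add: fock_space_def)
    have hol: "(\<lambda>\<zeta>. F (\<zeta>, 0)) holomorphic_on UNIV"
      using F by (intro holomorphic2_restrict_fst) (simp add: fock_space_def)
    have "\<exists>z w. F (z, w) \<noteq> F (z + \<i> * w, 0)"
    proof (rule ccontr)
      assume "\<not> ?thesis"
      then have "F = (\<lambda>p. F (fst p + \<i> * snd p, 0))" by (auto simp: fun_eq_iff)
      then have "F \<in> A_space \<nu>" 
        unfolding A_space_iff using l2 hol by (intro conjI exI[of _ "\<lambda>\<zeta>. F (\<zeta>, 0)"]) auto
      then show False using F by simp
    qed
    then obtain z w where zw: "F (z, w) \<noteq> F (z + \<i> * w, 0)" by blast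
    \<comment> \<open>Translation by \<open>q\<close> takes \<open>(z, w)\<close> to
      \<open>(z + \<i> * w, 0)\<close> and leaves every element of \<open>A_space\<close> unchanged,
      whereas it changes the value of \<open>F\<close> at \<open>(z, w)\<close>.\<close>
    define q where "q = (\<i> * w, - w)"
    have q: "fst q + \<i> * snd q = 0" by (simp add: q_def)
    \<comment> \<open>The form \<open>0 + p\<close> lets \<open>l2_space_gauss_shift\<close> also
      carry the unshifted \<open>F\<close> to the weight \<open>2 * \<nu>\<close>.\<close>
    define G where "G = (\<lambda>p. F (q + p)) - (\<lambda>p. F (0 + p))"
    have "G (z, w) \<noteq> 0" using zw by (simp add: G_def q_def add.commute)
    then have "G \<noteq> 0" by auto
    moreover have G2: "G \<in> l2_space ?M2"
      unfolding G_def by (intro l2_space_diff l2_space_gauss_shift l2 \<nu>)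
    moreover have "continuous_on UNIV G"
      unfolding G_def fun_diff_def
      by (intro continuous_intros continuous_on_compose2[OF continuous_on_fock_space[of F \<nu>]]) (use F in auto)
    ultimately have "l2_norm ?M2 G \<noteq> 0" using continuous_l2_norm_zero by blast
    then have G_pos: "l2_norm ?M2 G > 0" by (simp add: l2_norm_eq less_le)
    define C where "C = exp (\<nu> * (norm q)\<^sup>2) + 1"
    have "C > 0" by (simp add: C_def add_pos_pos)
    \<comment> \<open>Replacing \<open>F\<close> by \<open>F - H\<close> does not change
      \<open>G\<close>, as \<open>H\<close> is invariant under the shift. The two summands of
      \<open>C\<close> come from the shifts by \<open>q\<close> and by 0. Hence the ball of radius
      \<open>l2_norm ?M2 G / C\<close> around \<open>F\<close> misses
      \<open>A_space\<close>.\<close>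
    have "l2_norm ?M2 G \<le> C * l2_dist ?M F H" if H: "H \<in> A_space \<nu>" for H
    proof -
      have d: "F - H \<in> l2_space ?M" 
        using H l2 by (intro l2_space_diff) (auto simp: A_space_iff)
      have "l2_norm ?M2 G \<le> l2_norm ?M2 (\<lambda>p. (F - H) (q + p)) + l2_norm ?M2 (\<lambda>p. (F - H) (0 + p))"
      proof (rule l2_norm_triangle)
        fix p
        have "G p = (F - H) (q + p) - (F - H) (0 + p)"
          using A_space_shift[OF H q, of p] by (simp add: G_def)
        then show "norm (G p) \<le> norm ((F - H) (q + p)) + norm ((F - H) (0 + p))"
          by (metis norm_triangle_ineq4)
      qed (intro l2_space_gauss_shift d \<nu> G2)+
      also have "\<dots> \<le> exp (\<nu> * (norm q)\<^sup>2) * l2_norm ?M (F - H) + 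
         exp (\<nu> * (norm (0 :: complex \<times> complex))\<^sup>2) * l2_norm ?M (F - H)"
        by (intro add_mono l2_space_gauss_shift(2) d \<nu>)
      finally show ?thesis by (simp add: C_def l2_dist_def algebra_simps)
    qed
    then have "disjnt (A_space \<nu>) (mball F (l2_norm ?M2 G / C))"
      using \<open>C > 0\<close> by (fastforce simp: disjnt_iff field_simps)
    then show ?thesis using G_pos \<open>C > 0\<close> by (intro exI[of _ "l2_norm ?M2 G / C"]) auto
  qed
  then have "closedin mtopology (A_space \<nu>)"
    unfolding closedin_metric using sub by blast
  then show ?thesis
    unfolding closed_subspace_def l2_topology_def using sub subspace_A_space by blast
qed

section \<open>Coefficients of elements of \<open>A_space\<close> and the orthogonal basis\<close>

definition e_norm2 :: "real \<Rightarrow> nat \<Rightarrow> real" where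
  "e_norm2 \<nu> n = (pi / \<nu>)\<^sup>2 * (2 / \<nu>) ^ n * fact n"

lemma e_norm2_nonneg: "e_norm2 \<nu> n \<ge> 0" if "\<nu> > 0"
  using that by (simp add: e_norm2_def)

lemma power_series_gauss:
  fixes g :: "complex \<Rightarrow> complex"
  assumes g: "\<And>u. (\<lambda>n. a n * u ^ n) sums g u" and \<nu>: "\<nu> > 0"
  defines "F \<equiv> \<lambda>p. g (fst p + \<i> * snd p)"
  shows power_series_l2_space_iff: 
      "F \<in> l2_space (gauss_measure \<nu>) \<longleftrightarrow> summable (\<lambda>n. (norm (a n))\<^sup>2 * e_norm2 \<nu> n)"
    and power_series_l2_norm:
      "F \<in> l2_space (gauss_measure \<nu>) \<Longrightarrow> 
        l2_norm (gauss_measure \<nu>) F = sqrt (\<Sum>n. (norm (a n))\<^sup>2 * e_norm2 \<nu> n)"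
proof -
  let ?M = "gauss_measure \<nu> :: (complex \<times> complex) measure"
  let ?t = "\<lambda>n. (norm (a n))\<^sup>2 * e_norm2 \<nu> n"
  have t: "?t n \<ge> 0" for n using e_norm2_nonneg[OF \<nu>] by simp
  have "continuous_on UNIV F"
    unfolding F_def using holomorphic_on_imp_continuous_on[OF powser_entire[OF g]]
    by (rule continuous_on_compose2) (auto intro!: continuous_intros)
  then have [measurable]: "F \<in> borel_measurable borel" by (rule borel_measurable_continuous_onI)
  have nn: "(\<integral>\<^sup>+p. ennreal ((norm (F p))\<^sup>2) \<partial>?M) = (\<Sum>n. ennreal (?t n))"
    unfolding F_def power_series_parseval[OF g] nn_integral_norm_e_fun[OF \<nu>] e_norm2_def
    using \<nu> by (simp add: ennreal_mult)
  have "F \<in> l2_space ?M \<longleftrightarrow> (\<Sum>n. ennreal (?t n)) < top"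
    by (simp add: l2_space_def integrable_iff_bounded nn[symmetric])
  also have "\<dots> \<longleftrightarrow> summable ?t"
    using t by (auto simp: suminf_ennreal2 intro: summable_suminf_not_top)
  finally show iff: "F \<in> l2_space ?M \<longleftrightarrow> summable ?t" .
  assume F: "F \<in> l2_space ?M"
  then have "ennreal (\<integral>p. (norm (F p))\<^sup>2 \<partial>?M) = (\<Sum>n. ennreal (?t n))"
    unfolding nn[symmetric] by (subst nn_integral_eq_integral) (auto simp: l2_space_def)
  also have "\<dots> = ennreal (suminf ?t)" using F iff t by (intro suminf_ennreal2) auto
  finally show "l2_norm ?M F = sqrt (suminf ?t)"
    unfolding l2_norm_eq using F iff t by (subst (asm) ennreal_inj) (auto intro: suminf_nonneg)
qed

lemma A_space_power_series:
  assumes "F \<in> A_space \<nu>"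
  obtains g a where "\<And>u. (\<lambda>n. a n * u ^ n) sums g u" "F = (\<lambda>p. g (fst p + \<i> * snd p))"
proof -
  obtain g where g: "g holomorphic_on UNIV" "F = (\<lambda>p. g (fst p + \<i> * snd p))"
    using assms by (auto simp: A_space_iff)
  have "(\<lambda>n. (deriv ^^ n) g 0 / fact n * (u - 0) ^ n) sums g u" for u
    by (rule holomorphic_power_series[of g 0 "norm u + 1"]) (auto intro: holomorphic_on_subset[OF g(1)])
  then show thesis using g(2) by (intro that[where a = "\<lambda>n. (deriv ^^ n) g 0 / fact n"]) auto
qed

lemma A_space_power_seriesI:
  assumes g: "\<And>u. (\<lambda>n. a n * u ^ n) sums g u" and \<nu>: "\<nu> > 0"
    and "summable (\<lambda>n. (norm (a n))\<^sup>2 * e_norm2 \<nu> n)"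
  shows "(\<lambda>p. g (fst p + \<i> * snd p)) \<in> A_space \<nu>"
  unfolding A_space_iff using power_series_l2_space_iff[OF g \<nu>] assms(3) powser_entire[OF g] by blast

lemma e_fun_in_A_space:
  assumes \<nu>: "\<nu> > 0"
  shows "e_fun m \<in> A_space \<nu>"
proof -
  let ?a = "\<lambda>n. if n = m then 1 else 0 :: complex"
  have "(\<lambda>n. if n = m then u ^ n else 0) sums u ^ m" for u :: complex
    by (rule sums_single)
  then have s: "(\<lambda>n. ?a n * u ^ n) sums u ^ m" for u
    by (rule sums_cong[THEN iffD1, rotated]) simp
  have "(\<lambda>p. (fst p + \<i> * snd p) ^ m) \<in> A_space \<nu>"
    by (rule A_space_power_seriesI[OF s \<nu>]) (rule summable_finite[of "{m}"]; simp)
  then show ?thesis by (simp add: e_fun_eq[abs_def])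
qed

text \<open>Density holds because the distance from \<open>F\<close> to a Taylor polynomial is, by
  Parseval, the square root of a tail of a convergent series.\<close>

lemma orthogonal_basis_e_fun:
  assumes \<nu>: "\<nu> > 0"
  shows "orthogonal_basis (gauss_measure \<nu>) (A_space \<nu>) e_fun"
proof -
  let ?M = "gauss_measure \<nu> :: (complex \<times> complex) measure"
  interpret Metric_space "A_space \<nu>" "l2_dist ?M"
    by (rule Metric_space.subspace[OF Metric_space_fock_space]) (auto simp: A_space_def)
  have ne: "e_fun m \<noteq> 0" for m
  proof -
    have "e_fun m (1, 0) = 1" by (simp add: e_fun_def)
    then show ?thesis by auto
  qed
  have orth: "l2_inner ?M (e_fun m) (e_fun n) = 0" if "m \<noteq> n" for m n
    unfolding l2_inner_def using integral_e_fun_orthogonal[of "\<lambda>_. 1" m n \<nu>] that by simp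
  have dense: "\<exists>G\<in>cfun.span (range e_fun). G \<in> mball F r" if F: "F \<in> A_space \<nu>" and r: "r > 0" for F r
  proof -
    obtain g a where g: "\<And>u. (\<lambda>n. a n * u ^ n) sums g u" and Fg: "F = (\<lambda>p. g (fst p + \<i> * snd p))"
      by (rule A_space_power_series[OF F]) blast
    let ?t = "\<lambda>n. (norm (a n))\<^sup>2 * e_norm2 \<nu> n"
    have summ: "summable ?t"
      using F Fg power_series_l2_space_iff[OF g \<nu>] by (auto simp: A_space_iff)
    have "(\<lambda>k. \<Sum>n. ?t (n + k)) \<longlonglongrightarrow> 0"
      by (rule suminf_exist_split2[OF summ])
    then have "(\<lambda>k. sqrt (\<Sum>n. ?t (n + k))) \<longlonglongrightarrow> sqrt 0" by (rule tendsto_real_sqrt)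
    then have "eventually (\<lambda>k. sqrt (\<Sum>n. ?t (n + k)) < r) sequentially"
      using r by (intro order_tendstoD(2)) auto
    then obtain k where k: "sqrt (\<Sum>n. ?t (n + k)) < r"
      by (auto simp: eventually_sequentially)
    define G where "G = (\<Sum>n<k. (\<lambda>p. a n * e_fun n p))"
    have G_span: "G \<in> cfun.span (range e_fun)"
      unfolding G_def by (intro cfun.span_sum cfun.span_scale cfun.span_base) auto
    have "cfun.span (range e_fun) \<subseteq> A_space \<nu>"
      by (intro cfun.span_minimal subspace_A_space) (auto intro: e_fun_in_A_space \<nu>)
    with G_span have G: "G \<in> A_space \<nu>" by auto
    define h where "h u = g u - (\<Sum>n<k. a n * u ^ n)" for u
    define b where "b n = (if n < k then 0 else a n)" for n
    have h: "(\<lambda>n. b n * u ^ n) sums h u" for u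
    proof -
      have "(\<lambda>n. if n \<in> {..<k} then a n * u ^ n else 0) sums (\<Sum>n<k. a n * u ^ n)"
        by (rule sums_If_finite_set) auto
      from sums_diff[OF g this] show ?thesis
        unfolding h_def by (rule sums_cong[THEN iffD1, rotated]) (auto simp: b_def)
    qed
    have "G p = (\<Sum>n<k. a n * e_fun n p)" for p
      unfolding G_def by (induction k) auto
    then have FG: "F - G = (\<lambda>p. h (fst p + \<i> * snd p))"
      by (auto simp: fun_eq_iff Fg h_def e_fun_eq)
    have "F - G \<in> l2_space ?M" using F G by (auto simp: A_space_iff intro: l2_space_diff)
    then have "l2_norm ?M (F - G) = sqrt (\<Sum>n. (norm (b n))\<^sup>2 * e_norm2 \<nu> n)"
      unfolding FG by (rule power_series_l2_norm[OF h \<nu>])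
    also have "(\<Sum>n. (norm (b n))\<^sup>2 * e_norm2 \<nu> n) = (\<Sum>n. ?t (n + k))"
    proof -
      have "summable (\<lambda>n. (norm (b n))\<^sup>2 * e_norm2 \<nu> n)"
        by (rule summable_comparison_test'[OF summ, of 0]) (auto simp: b_def e_norm2_nonneg[OF \<nu>])
      from suminf_split_initial_segment[OF this, of k] show ?thesis by (simp add: b_def)
    qed
    finally have "l2_dist ?M F G < r" using k by (simp only: l2_dist_def)
    then show ?thesis using F G G_span by auto
  qed
  have "mtopology closure_of (cfun.span (range e_fun)) = A_space \<nu>"
    unfolding metric_closure_of using dense by blast
  then show ?thesis
    unfolding orthogonal_basis_def l2_topology_def using e_fun_in_A_space[OF \<nu>] ne orth by blast
qed

subsection \<open>Hermite polynomials\<close>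

lemma integrable_gauss_power:
  assumes \<nu>: "\<nu> > 0"
  shows "integrable (gauss_measure \<nu>) (\<lambda>x::real. x ^ k)"
proof -
  define \<sigma> where "\<sigma> = 1 / sqrt (2 * \<nu>)"
  have \<sigma>: "\<sigma> > 0" "\<sigma>\<^sup>2 = 1 / (2 * \<nu>)" using \<nu> by (auto simp: \<sigma>_def power_divide)
  have "exp (- \<nu> * (norm x)\<^sup>2) = sqrt (2 * pi * \<sigma>\<^sup>2) * normal_density 0 \<sigma> x" for x :: real
    using \<nu> \<sigma>(1) by (simp add: normal_density_def \<sigma>(2) mult.commute)
  then show ?thesis
    using integrable_mult_right[OF integrable_normal_moment[OF \<sigma>(1), of 0 k], of "sqrt (2 * pi * \<sigma>\<^sup>2)"]
    by (subst integrable_gauss_measure) (auto simp: mult.assoc)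
qed

lemma integrable_gauss_poly:
  fixes p :: "real poly"
  assumes "\<nu> > 0"
  shows "integrable (gauss_measure \<nu>) (poly p)"
  unfolding poly_altdef using integrable_gauss_power[OF assms] by (intro Bochner_Integration.integrable_sum) simp

lemma measurable_poly [measurable]: "(poly p :: real \<Rightarrow> real) \<in> borel_measurable borel"
  by (intro borel_measurable_continuous_onI continuous_intros)

lemma measure_gauss_real:
  assumes \<nu>: "\<nu> > 0"
  shows "(\<integral>x. 1 \<partial>(gauss_measure \<nu> :: real measure)) = sqrt (pi / \<nu>)"
proof -
  have "(\<integral>\<^sup>+x. ennreal 1 \<partial>(gauss_measure \<nu> :: real measure)) = ennreal (sqrt (pi / \<nu>))"
    using nn_integral_exp_linear_gauss_measure[OF \<nu>, of "0::real"] by simp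
  then show ?thesis using \<nu> by (subst integral_eq_nn_integral) auto
qed

text \<open>The function \<open>(p' - 2 * \<nu> * x * p) * exp (- \<nu> * x^2)\<close> is the
  derivative of \<open>p * exp (- \<nu> * x^2)\<close>, which tends to 0 at both ends of the
  line.\<close>

lemma gauss_poly_integration_by_parts:
  fixes p :: "real poly"
  assumes \<nu>: "\<nu> > 0"
  shows "(\<integral>x. poly (pderiv p) x \<partial>gauss_measure \<nu>) = 2 * \<nu> * (\<integral>x. poly ([:0, 1:] * p) x \<partial>gauss_measure \<nu>)"
proof -
  let ?e = "\<lambda>x::real. exp (- \<nu> * x\<^sup>2)"
  let ?q = "pderiv p - smult (2 * \<nu>) ([:0, 1:] * p)"
  \<comment> \<open>An arbitrary filter lets one reduction to monomials serve both ends.\<close>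
  have lim: "((\<lambda>x. poly p x * ?e x) \<longlongrightarrow> 0) F"
    if "\<And>k. ((\<lambda>x. x ^ k * ?e x) \<longlongrightarrow> 0) F" for F
  proof -
    have "((\<lambda>x. \<Sum>i\<le>degree p. coeff p i * (x ^ i * ?e x)) \<longlongrightarrow> (\<Sum>i\<le>degree p. coeff p i * 0)) F"
      by (intro tendsto_intros that)
    then show ?thesis by (simp add: poly_altdef sum_distrib_right mult.assoc)
  qed
  have "(\<integral>x. poly ?q x \<partial>gauss_measure \<nu>) = (\<integral>x. ?e x * poly ?q x \<partial>lborel)"
    by (subst integral_gauss_measure) auto
  also have "\<dots> = (LBINT x=-\<infinity>..\<infinity>. ?e x * poly ?q x)"
    by (simp add: interval_lebesgue_integral_def set_lebesgue_integral_def)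
  also have "\<dots> = 0 - 0"
  proof (rule interval_integral_FTC_integrable)
    fix x :: real
    have "((\<lambda>x. poly p x * ?e x) has_real_derivative ?e x * poly ?q x) (at x)"
      by (auto intro!: derivative_eq_intros simp: algebra_simps)
    then show "((\<lambda>x. poly p x * ?e x) has_vector_derivative ?e x * poly ?q x) (at x)"
      by (simp add: has_real_derivative_iff_has_vector_derivative)
    show "isCont (\<lambda>x. ?e x * poly ?q x) x" by (intro continuous_intros)
  next
    show "set_integrable lborel (einterval (-\<infinity>) \<infinity>) (\<lambda>x. ?e x * poly ?q x)"
      using integrable_gauss_poly[OF \<nu>, of ?q]
      by (simp add: set_integrable_def integrable_gauss_measure)
    show "(((\<lambda>x. poly p x * ?e x) \<circ> real_of_ereal) \<longlongrightarrow> 0) (at_right (-\<infinity>))"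
      unfolding ereal_tendsto_simps1 by (rule lim) (use \<nu> in real_asymp)
    show "(((\<lambda>x. poly p x * ?e x) \<circ> real_of_ereal) \<longlongrightarrow> 0) (at_left \<infinity>)"
      unfolding ereal_tendsto_simps1 by (rule lim) (use \<nu> in real_asymp)
  qed simp
  finally have "(\<integral>x. poly ?q x \<partial>gauss_measure \<nu>) = 0" by simp
  moreover have "(\<integral>x. poly ?q x \<partial>gauss_measure \<nu>) = 
    (\<integral>x. poly (pderiv p) x \<partial>gauss_measure \<nu>) - (\<integral>x. poly (smult (2 * \<nu>) ([:0, 1:] * p)) x \<partial>gauss_measure \<nu>)"
    unfolding poly_diff by (intro Bochner_Integration.integral_diff integrable_gauss_poly \<nu>)
  ultimately show ?thesis unfolding poly_smult integral_mult_right_zero by linarith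
qed

text \<open>
  Scaled Hermite polynomials: the coefficients of \<open>z ^ n\<close> in \<open>exp (\<surd>2 \<nu> x z - \<nu> z\<^sup>2 / 2)\<close>, the kernel of
  the Segal-Bargmann transform with respect to the Gaussian measure.
\<close>

fun hermite :: "real \<Rightarrow> nat \<Rightarrow> real poly" where
  "hermite \<nu> 0 = 1"
| "hermite \<nu> (Suc 0) = [:0, sqrt 2 * \<nu>:]"
| "hermite \<nu> (Suc (Suc n)) = 
    smult (1 / real (n + 2)) ([:0, sqrt 2 * \<nu>:] * hermite \<nu> (Suc n) - smult \<nu> (hermite \<nu> n))"

text \<open>Index \<open>n - 1\<close>, with the zero polynomial at index -1: the recurrence and the
  derivative formula then hold from n = 0 on.\<close>

definition hermite_pred :: "real \<Rightarrow> nat \<Rightarrow> real poly" where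
  "hermite_pred \<nu> n = (case n of 0 \<Rightarrow> 0 | Suc k \<Rightarrow> hermite \<nu> k)"

lemma hermite_pred_simps [simp]: "hermite_pred \<nu> 0 = 0" "hermite_pred \<nu> (Suc n) = hermite \<nu> n"
  by (simp_all add: hermite_pred_def)

lemma hermite_Suc:
  "smult (real (Suc n)) (hermite \<nu> (Suc n)) = [:0, sqrt 2 * \<nu>:] * hermite \<nu> n - smult \<nu> (hermite_pred \<nu> n)"
  by (cases n) (auto simp: divide_simps)

text \<open>Differentiating the generating function in x multiplies it by
  \<open>sqrt 2 * \<nu> * z\<close>, which shifts the index. The proof obtains this from the
  recurrence by induction.\<close>

lemma pderiv_hermite: "pderiv (hermite \<nu> n) = smult (sqrt 2 * \<nu>) (hermite_pred \<nu> n)"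
proof (induction \<nu> n rule: hermite.induct)
  case (3 \<nu> n)
  let ?c = "sqrt 2 * \<nu>"
  have "smult (real (n + 2)) (pderiv (hermite \<nu> (Suc (Suc n)))) = 
     pderiv ([:0, ?c:] * hermite \<nu> (Suc n) - smult \<nu> (hermite \<nu> n))"
    by (simp add: pderiv_smult del: mult_pCons_left)
  also have "\<dots> = smult ?c (hermite \<nu> (Suc n)) + [:0, ?c:] * smult ?c (hermite \<nu> n) - 
      smult \<nu> (smult ?c (hermite_pred \<nu> n))"
    by (simp only: pderiv_diff pderiv_mult pderiv_smult 3) (simp add: pderiv_pCons)
  also have "\<dots> = smult ?c (hermite \<nu> (Suc n) + ([:0, ?c:] * hermite \<nu> n - smult \<nu> (hermite_pred \<nu> n)))"
    by (simp add: smult_diff_right smult_add_right mult.commute mult.left_commute)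
  also have "\<dots> = smult (real (n + 2)) (smult ?c (hermite \<nu> (Suc n)))"
  proof -
    have "smult (real (n + 2)) q = smult (1 + real (Suc n)) q" for q :: "real poly" by simp
    then have "smult (real (n + 2)) q = q + smult (real (Suc n)) q" for q :: "real poly" 
      by (simp only: smult_add_left smult_1_left)
    then show ?thesis unfolding hermite_Suc[symmetric] by (metis smult_smult mult.commute)
  qed
  finally have "smult (1 / real (n + 2)) (smult (real (n + 2)) (pderiv (hermite \<nu> (Suc (Suc n))))) = 
     smult (1 / real (n + 2)) (smult (real (n + 2)) (smult ?c (hermite \<nu> (Suc n))))"
    by (rule arg_cong)
  then show ?case by simp
qed (auto simp: pderiv_pCons)

text \<open>The recurrence for \<open>hermite \<nu> (Suc n)\<close> produces a factor x, which
  integration by parts turns into a derivative of the product. Its part with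
  \<open>hermite_pred \<nu> n\<close> cancels the second term of the recurrence, so both indices
  drop by one.\<close>

lemma hermite_recurrence_integral:
  assumes \<nu>: "\<nu> > 0"
  shows "real (Suc n) * (\<integral>x. poly (hermite \<nu> m * hermite \<nu> (Suc n)) x \<partial>gauss_measure \<nu>) = 
    \<nu> * (\<integral>x. poly (hermite_pred \<nu> m * hermite \<nu> n) x \<partial>gauss_measure \<nu>)"
proof -
  define L where "L p = (\<integral>x. poly p x \<partial>gauss_measure \<nu>)" for p :: "real poly"
  have L_add: "L (p + q) = L p + L q" for p q
    unfolding L_def poly_add by (intro Bochner_Integration.integral_add integrable_gauss_poly \<nu>)
  have L_diff: "L (p - q) = L p - L q" for p q
    unfolding L_def poly_diff by (intro Bochner_Integration.integral_diff integrable_gauss_poly \<nu>)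
  have L_smult: "L (smult c p) = c * L p" for c p
    unfolding L_def poly_smult by simp
  have L_pderiv: "L (pderiv p) = 2 * \<nu> * L ([:0, 1:] * p)" for p
    unfolding L_def gauss_poly_integration_by_parts[OF \<nu>] ..
  let ?c = "sqrt 2 * \<nu>" and ?h = "hermite \<nu>" and ?h' = "hermite_pred \<nu>"
  have "real (Suc n) * L (?h m * ?h (Suc n)) = L (?h m * smult (real (Suc n)) (?h (Suc n)))"
    by (simp add: L_smult del: of_nat_Suc)
  also have "?h m * smult (real (Suc n)) (?h (Suc n)) = 
      smult ?c ([:0, 1:] * (?h m * ?h n)) - smult \<nu> (?h m * ?h' n)"
    unfolding hermite_Suc by (simp add: algebra_simps)
  also have "L \<dots> = ?c * L ([:0, 1:] * (?h m * ?h n)) - \<nu> * L (?h m * ?h' n)"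
    by (simp only: L_diff L_smult)
  also have "?c * L ([:0, 1:] * (?h m * ?h n)) = (1 / sqrt 2) * L (pderiv (?h m * ?h n))"
    unfolding L_pderiv by (simp add: field_simps)
  also have "pderiv (?h m * ?h n) = smult ?c (?h m * ?h' n + ?h' m * ?h n)"
    unfolding pderiv_mult pderiv_hermite by (simp add: smult_add_right mult.commute)
  also have "(1 / sqrt 2) * L \<dots> = \<nu> * (L (?h m * ?h' n) + L (?h' m * ?h n))"
    unfolding L_smult L_add by simp
  also have "\<dots> - \<nu> * L (?h m * ?h' n) = \<nu> * L (?h' m * ?h n)" by (simp only: distrib_left add_diff_cancel_left')
  finally show ?thesis unfolding L_def .
qed

text \<open>The total mass \<open>sqrt (pi / \<nu>)\<close> times one factor
  \<open>\<nu> / k\<close> for each k from 1 to n, as \<open>hermite_recurrence_integral\<close>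
  dictates.\<close>

definition hermite_norm2 :: "real \<Rightarrow> nat \<Rightarrow> real" where
  "hermite_norm2 \<nu> n = sqrt (pi / \<nu>) * \<nu> ^ n / fact n"

lemma hermite_orthogonal:
  assumes \<nu>: "\<nu> > 0"
  shows "(\<integral>x. poly (hermite \<nu> m * hermite \<nu> n) x \<partial>gauss_measure \<nu>) = (if m = n then hermite_norm2 \<nu> n else 0)"
proof (induction n arbitrary: m)
  case 0
  show ?case
  proof (cases m)
    case 0
    then show ?thesis using measure_gauss_real[OF \<nu>] by (simp add: hermite_norm2_def)
  next
    case (Suc k)
    \<comment> \<open>The indices are exchanged here: the recurrence lowers index 0 to the zero
      polynomial.\<close>
    then show ?thesis using hermite_recurrence_integral[OF \<nu>, of k 0] by (simp add: mult.commute)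
  qed
next
  case (Suc n)
  show ?case
  proof (cases m)
    case 0
    then show ?thesis using hermite_recurrence_integral[OF \<nu>, of n m] by simp
  next
    case (Suc k)
    then have eq: "real (Suc n) * (\<integral>x. poly (hermite \<nu> m * hermite \<nu> (Suc n)) x \<partial>gauss_measure \<nu>) = 
       \<nu> * (if k = n then hermite_norm2 \<nu> n else 0)"
      using hermite_recurrence_integral[OF \<nu>, of n m] Suc.IH[of k] by simp
    then show ?thesis 
    proof (cases "k = n")
      case True
      have "hermite_norm2 \<nu> (Suc n) * real (Suc n) = \<nu> * hermite_norm2 \<nu> n"
        by (simp add: hermite_norm2_def fact_Suc del: of_nat_Suc)
      then have "real (Suc n) * (\<integral>x. poly (hermite \<nu> m * hermite \<nu> (Suc n)) x \<partial>gauss_measure \<nu>) = 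
          real (Suc n) * hermite_norm2 \<nu> (Suc n)"
        using eq True by (simp only: if_True refl mult.commute)
      then have "(\<integral>x. poly (hermite \<nu> m * hermite \<nu> (Suc n)) x \<partial>gauss_measure \<nu>) = hermite_norm2 \<nu> (Suc n)"
        by (rule mult_left_cancel[THEN iffD1, rotated]) simp
      then show ?thesis using True Suc by (simp only: if_True refl)
    next
      case False
      then have "(\<integral>x. poly (hermite \<nu> m * hermite \<nu> (Suc n)) x \<partial>gauss_measure \<nu>) = 0"
        using eq by (simp del: poly_mult of_nat_Suc)
      then show ?thesis using False Suc by simp
    qed
  qed
qed

text \<open>For fixed x the kernel \<open>K\<close> is entire and solves
  \<open>K' = (C - \<nu> * z) * K\<close> with \<open>K 0 = 1\<close>. Comparing coefficients in
  this equation gives the recurrence that defines \<open>hermite\<close>.\<close>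

lemma hermite_generating_function:
  fixes z :: complex
  shows "(\<lambda>n. of_real (poly (hermite \<nu> n) x) * z ^ n) sums 
    exp (of_real (sqrt 2 * \<nu> * x) * z - of_real \<nu> * z\<^sup>2 / 2)"
proof -
  define C where "C = complex_of_real (sqrt 2 * \<nu> * x)"
  define K where "K z = exp (C * z - of_real \<nu> * z\<^sup>2 / 2)" for z
  have hol: "K holomorphic_on A" for A unfolding K_def by (intro holomorphic_intros) auto
  define F where "F = fps_expansion K 0"
  have F: "K has_fps_expansion F"
    unfolding F_def by (rule has_fps_expansion_fps_expansion[of UNIV]) (auto intro: hol)
  have "deriv K = (\<lambda>z. (C - of_real \<nu> * z) * K z)"
    unfolding K_def by (intro ext DERIV_imp_deriv) (auto intro!: derivative_eq_intros simp: algebra_simps)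
  moreover have "(\<lambda>z. (C - of_real \<nu> * z) * K z) has_fps_expansion 
      (fps_const C - fps_const (of_real \<nu>) * fps_X) * F"
    by (intro fps_expansion_intros F)
  ultimately have eq: "fps_deriv F = (fps_const C - fps_const (of_real \<nu>) * fps_X) * F"
    using has_fps_expansion_deriv[OF F] fps_expansion_unique_complex by metis
  have rec: "of_nat (Suc n) * fps_nth F (Suc n) = C * fps_nth F n - of_real \<nu> * (if n = 0 then 0 else fps_nth F (n - 1))" for n
  proof -
    have "of_nat (Suc n) * fps_nth F (Suc n) = fps_nth (fps_deriv F) n" by simp
    also have "\<dots> = C * fps_nth F n - of_real \<nu> * (if n = 0 then 0 else fps_nth F (n - 1))"
      unfolding eq by (simp add: left_diff_distrib mult.assoc)
    finally show ?thesis .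
  qed
  have F0: "fps_nth F 0 = 1" by (simp add: F_def fps_expansion_def K_def)
  have nth: "fps_nth F n = of_real (poly (hermite \<nu> n) x)" for n
  proof (induction n rule: induct_nat_012)
    case 0
    then show ?case by (simp add: F0)
  next
    case 1
    then show ?case using rec[of 0] by (simp add: F0 C_def mult_ac)
  next
    case (ge2 n)
    have "of_nat (n + 2) * fps_nth F (Suc (Suc n)) = 
        of_real (poly ([:0, sqrt 2 * \<nu>:] * hermite \<nu> (Suc n) - smult \<nu> (hermite \<nu> n)) x)"
      using rec[of "Suc n"] ge2 by (simp add: C_def mult_ac)
    moreover have "of_nat (n + 2) * complex_of_real (poly (hermite \<nu> (Suc (Suc n))) x) = 
        of_real (poly ([:0, sqrt 2 * \<nu>:] * hermite \<nu> (Suc n) - smult \<nu> (hermite \<nu> n)) x)"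
    proof -
      have "real (n + 2) * poly (hermite \<nu> (Suc (Suc n))) x = 
          poly ([:0, sqrt 2 * \<nu>:] * hermite \<nu> (Suc n) - smult \<nu> (hermite \<nu> n)) x"
        by (simp del: mult_pCons_left poly_diff poly_mult)
      then show ?thesis by (metis of_real_mult of_real_of_nat_eq)
    qed
    ultimately show ?case by (metis mult_left_cancel of_nat_eq_0_iff add_is_0 zero_neq_numeral)
  qed
  have "(\<lambda>n. (deriv ^^ n) K 0 / fact n * (z - 0) ^ n) sums K z"
    by (rule holomorphic_power_series[of K 0 "norm z + 1"]) (auto intro: hol)
  then have "(\<lambda>n. fps_nth F n * z ^ n) sums K z"
    by (simp add: F_def fps_expansion_def)
  then show ?thesis unfolding nth by (simp add: K_def C_def)
qed

subsection \<open>The transforms\<close>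

definition hermite_fun :: "real \<Rightarrow> nat \<Rightarrow> real \<Rightarrow> complex" where
  "hermite_fun \<nu> n x = of_real (poly (hermite \<nu> n) x)"

lemma hermite_fun_l2_space:
  assumes \<nu>: "\<nu> > 0"
  shows "hermite_fun \<nu> n \<in> l2_space (gauss_measure \<nu>)"
proof -
  have "integrable (gauss_measure \<nu>) (poly (hermite \<nu> n * hermite \<nu> n))"
    by (rule integrable_gauss_poly[OF \<nu>])
  then show ?thesis
    by (auto simp: l2_space_def hermite_fun_def[abs_def] power2_eq_square poly_mult[abs_def])
qed

lemma l2_inner_hermite_fun:
  assumes \<nu>: "\<nu> > 0"
  shows "l2_inner (gauss_measure \<nu>) (hermite_fun \<nu> m) (hermite_fun \<nu> n) = 
    (if m = n then of_real (hermite_norm2 \<nu> n) else 0)"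
proof -
  have "l2_inner (gauss_measure \<nu>) (hermite_fun \<nu> m) (hermite_fun \<nu> n) = 
      (\<integral>x. complex_of_real (poly (hermite \<nu> m * hermite \<nu> n) x) \<partial>gauss_measure \<nu>)"
    by (simp add: l2_inner_def hermite_fun_def)
  also have "\<dots> = of_real (if m = n then hermite_norm2 \<nu> n else 0)"
    unfolding integral_complex_of_real hermite_orthogonal[OF \<nu>] ..
  finally show ?thesis by simp
qed

lemma hermite_norm2_pos: "\<nu> > 0 \<Longrightarrow> hermite_norm2 \<nu> n > 0"
  by (simp add: hermite_norm2_def)

lemma l2_norm_hermite_fun:
  assumes \<nu>: "\<nu> > 0"
  shows "(l2_norm (gauss_measure \<nu>) (hermite_fun \<nu> n))\<^sup>2 = hermite_norm2 \<nu> n"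
proof -
  have "complex_of_real ((l2_norm (gauss_measure \<nu>) (hermite_fun \<nu> n))\<^sup>2) = of_real (hermite_norm2 \<nu> n)"
    unfolding l2_norm_sq l2_inner_hermite_fun[OF \<nu>] by simp
  then show ?thesis by (simp only: of_real_eq_iff)
qed

text \<open>Expanding the square splits off \<open>exp (- \<nu> * x^2)\<close>, which becomes the
  measure; the rest of the kernel is the generating function.\<close>

lemma bargmann_kernel:
  assumes [measurable]: "f \<in> borel_measurable borel"
  shows "bargmann \<nu> f z = of_real ((\<nu> / pi) powr (3/4)) * 
    (\<integral>x. f x * exp (of_real (sqrt 2 * \<nu> * x) * z - of_real \<nu> * z\<^sup>2 / 2) \<partial>gauss_measure \<nu>)"
proof -
  have s2: "complex_of_real (sqrt 2) * complex_of_real (sqrt 2) = 2"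
    by (simp flip: of_real_mult)
  have kernel: "f x * exp (- of_real \<nu> * (of_real x - z / of_real (sqrt 2))\<^sup>2) = 
     exp (- \<nu> * (norm x)\<^sup>2) *\<^sub>R (f x * exp (of_real (sqrt 2 * \<nu> * x) * z - of_real \<nu> * z\<^sup>2 / 2))" for x
  proof -
    have "z / of_real (sqrt 2) = of_real (sqrt 2) * z / 2"
      using s2 by (simp add: field_simps)
    then have "- of_real \<nu> * (of_real x - z / of_real (sqrt 2))\<^sup>2 = 
        of_real (- \<nu> * x\<^sup>2) + (of_real (sqrt 2 * \<nu> * x) * z - of_real \<nu> * z\<^sup>2 / 2)"
      using s2 by (simp add: power2_eq_square field_simps)
    then show ?thesis
      by (simp only: exp_add exp_of_real scaleR_conv_of_real real_norm_def power2_abs mult.left_commute)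
  qed
  have "(\<lambda>x. f x * exp (of_real (sqrt 2 * \<nu> * x) * z - of_real \<nu> * z\<^sup>2 / 2)) \<in> borel_measurable borel"
    by (intro borel_measurable_times assms borel_measurable_continuous_onI continuous_intros) auto
  then show ?thesis
    unfolding bargmann_def kernel by (subst integral_gauss_measure) (assumption, rule refl)
qed

text \<open>After Cauchy-Schwarz, this series at \<open>r = norm z\<close> is the majorant for
  termwise integration in \<open>bargmann_power_series\<close>.\<close>

lemma hermite_norm_summable:
  assumes \<nu>: "\<nu> > 0"
  shows "summable (\<lambda>n. sqrt (hermite_norm2 \<nu> n) * r ^ n)"
proof -
  \<comment> \<open>Weighted arithmetic-geometric mean inequality, with the weight \<open>4\<^sup>n\<close> absorbed by the factorial.\<close>
  let ?b = "\<lambda>n. sqrt (pi / \<nu>) * ((4 * \<nu> * r\<^sup>2) ^ n / fact n) + (1/4) ^ n"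
  have "summable (\<lambda>n. (4 * \<nu> * r\<^sup>2) ^ n / fact n)"
    using summable_exp[of "4 * \<nu> * r\<^sup>2"] by (simp add: field_simps)
  then have "summable ?b" by (intro summable_add summable_mult summable_geometric) auto
  then show ?thesis
  proof (rule summable_comparison_test')
    fix n
    define A where "A = hermite_norm2 \<nu> n"
    define y where "y = sqrt A * \<bar>r\<bar> ^ n"
    have A: "A \<ge> 0" using hermite_norm2_pos[OF \<nu>, of n] by (simp add: A_def)
    \<comment> \<open>The cross term of the square is \<open>- 2 * y\<close>; adding
      \<open>y\<close> leaves \<open>- y\<close>, and the estimate can be solved for
      \<open>y\<close>.\<close>
    have "0 \<le> (2 ^ n * y - (1/2) ^ n)\<^sup>2 + y" using A by (simp add: y_def)
    also have "\<dots> = 4 ^ n * y\<^sup>2 + (1/4) ^ n - y"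
    proof -
      have "(2 ^ n * y - (1/2) ^ n)\<^sup>2 = (2 ^ n * 2 ^ n) * y\<^sup>2 + ((1/2) ^ n * (1/2) ^ n) - 2 * (2 ^ n * (1/2) ^ n) * y"
        by (simp only: power2_eq_square) (simp add: algebra_simps)
      then show ?thesis unfolding power_mult_distrib[symmetric] by simp
    qed
    finally have "y \<le> 4 ^ n * y\<^sup>2 + (1/4) ^ n" by simp
    also have "4 ^ n * y\<^sup>2 = sqrt (pi / \<nu>) * ((4 * \<nu> * r\<^sup>2) ^ n / fact n)"
      using A unfolding y_def 
      by (simp add: power_mult_distrib A_def hermite_norm2_def flip: power_mult)
         (simp add: power_even_abs mult.commute)
    finally show "norm (sqrt (hermite_norm2 \<nu> n) * r ^ n) \<le> ?b n"
      using A by (simp add: y_def A_def abs_mult power_abs)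
  qed
qed

lemma finite_measure_gauss_real:
  assumes \<nu>: "\<nu> > 0"
  shows "finite_measure (gauss_measure \<nu> :: real measure)"
proof
  have "(\<integral>\<^sup>+x. 1 \<partial>(gauss_measure \<nu> :: real measure)) = ennreal (sqrt (pi / \<nu>))"
    using nn_integral_exp_linear_gauss_measure[OF \<nu>, of "0::real"] by simp
  then show "emeasure (gauss_measure \<nu> :: real measure) (space (gauss_measure \<nu>)) \<noteq> \<infinity>"
    by simp
qed

lemma bargmann_power_series:
  assumes \<nu>: "\<nu> > 0" and f: "f \<in> l2_space (gauss_measure \<nu>)"
  shows "(\<lambda>n. of_real ((\<nu> / pi) powr (3/4)) * l2_inner (gauss_measure \<nu>) f (hermite_fun \<nu> n) * z ^ n) 
    sums bargmann \<nu> f z"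
proof -
  let ?M = "gauss_measure \<nu> :: real measure"
  let ?h = "hermite_fun \<nu>"
  let ?t = "\<lambda>n x. f x * (?h n x * z ^ n)"
  have [measurable]: "f \<in> borel_measurable borel" using f by (simp add: l2_space_def)
  have h: "?h n \<in> l2_space ?M" for n by (rule hermite_fun_l2_space[OF \<nu>])
  have gen: "(\<lambda>n. ?h n x * w ^ n) sums exp (of_real (sqrt 2 * \<nu> * x) * w - of_real \<nu> * w\<^sup>2 / 2)" for x w
    unfolding hermite_fun_def by (rule hermite_generating_function)
  have int: "integrable ?M (?t n)" for n
    using integrable_mult_left[OF l2_space_integrable_mult[OF f h[of n]], of "z ^ n"] by (simp add: mult.assoc)
  have sums: "(\<lambda>n. \<integral>x. ?t n x \<partial>?M) sums (\<integral>x. (\<Sum>n. ?t n x) \<partial>?M)"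
  proof (rule sums_integral[OF int])
    show "AE x in ?M. summable (\<lambda>n. norm (?t n x))"
    proof (rule AE_I2)
      fix x
      have "summable (\<lambda>n. norm (?h n x * z ^ n))"
        by (rule powser_insidea[OF sums_summable[OF gen[of x "of_real (norm z + 1)"]]]) simp
      then show "summable (\<lambda>n. norm (?t n x))" by (simp add: norm_mult summable_mult)
    qed
    show "summable (\<lambda>n. \<integral>x. norm (?t n x) \<partial>?M)"
    proof (rule summable_comparison_test')
      show "summable (\<lambda>n. l2_norm ?M f * (sqrt (hermite_norm2 \<nu> n) * norm z ^ n))"
        by (intro summable_mult hermite_norm_summable \<nu>)
      fix n
      have "(\<integral>x. norm (?t n x) \<partial>?M) = (\<integral>x. norm (f x * ?h n x) \<partial>?M) * norm z ^ n"
        by (simp add: norm_mult norm_power mult.assoc[symmetric])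
      also have "\<dots> \<le> (l2_norm ?M f * l2_norm ?M (?h n)) * norm z ^ n"
        by (intro mult_right_mono l2_integral_norm_mult_le f h) auto
      also have "l2_norm ?M (?h n) = sqrt (hermite_norm2 \<nu> n)"
        using l2_norm_hermite_fun[OF \<nu>, of n] l2_norm_nonneg[of ?M "?h n"] by (metis real_sqrt_unique)
      finally show "norm (\<integral>x. norm (?t n x) \<partial>?M) \<le> l2_norm ?M f * (sqrt (hermite_norm2 \<nu> n) * norm z ^ n)"
        by (simp add: mult.assoc)
    qed
  qed
  \<comment> \<open>\<open>hermite_fun\<close> is real-valued, so the conjugation in
    \<open>l2_inner\<close> disappears.\<close>
  have coeff: "(\<integral>x. ?t n x \<partial>?M) = l2_inner ?M f (?h n) * z ^ n" for n
    by (simp add: l2_inner_def hermite_fun_def mult.assoc[symmetric])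
  have kernel: "(\<Sum>n. ?t n x) = f x * exp (of_real (sqrt 2 * \<nu> * x) * z - of_real \<nu> * z\<^sup>2 / 2)" for x
    using sums_mult[OF gen[of x z], of "f x"] by (simp add: sums_iff)
  show ?thesis
    using sums unfolding bargmann_kernel[OF \<open>f \<in> borel_measurable borel\<close>] mult.assoc coeff kernel 
    by (rule sums_mult)
qed

section \<open>The range of \<open>G_transform\<close>\<close>

definition G_coeff :: "real \<Rightarrow> nat \<Rightarrow> real" where
  "G_coeff \<nu> n = (\<nu> / pi) powr (1/2) * (\<nu> / pi) powr (3/4) / sqrt 2 ^ n"

lemma G_transform_power_series:
  assumes \<nu>: "\<nu> > 0" and f: "f \<in> l2_space (gauss_measure \<nu>)"
  defines "g \<equiv> \<lambda>u. of_real ((\<nu> / pi) powr (1/2)) * bargmann \<nu> f (u / of_real (sqrt 2))"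
  shows "(\<lambda>n. of_real (G_coeff \<nu> n) * l2_inner (gauss_measure \<nu>) f (hermite_fun \<nu> n) * u ^ n) sums g u"
    and "G_transform \<nu> f = (\<lambda>p. g (fst p + \<i> * snd p))"
proof -
  show "(\<lambda>n. of_real (G_coeff \<nu> n) * l2_inner (gauss_measure \<nu>) f (hermite_fun \<nu> n) * u ^ n) sums g u"
    using sums_mult[OF bargmann_power_series[OF \<nu> f, of "u / of_real (sqrt 2)"], 
        of "of_real ((\<nu> / pi) powr (1/2))"]
    unfolding g_def by (simp add: G_coeff_def power_divide mult_ac)
  show "G_transform \<nu> f = (\<lambda>p. g (fst p + \<i> * snd p))"
    by (simp add: G_transform_def g_def split_beta fun_eq_iff)
qed

text \<open>This is the computation that makes \<open>G_transform\<close> isometric.\<close>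

lemma G_coeff_norm:
  assumes \<nu>: "\<nu> > 0"
  shows "(G_coeff \<nu> n)\<^sup>2 * e_norm2 \<nu> n * hermite_norm2 \<nu> n = 1"
proof -
  have "(G_coeff \<nu> n)\<^sup>2 = (\<nu> / pi) powr (5/2) / 2 ^ n"
  proof -
    have "(\<nu> / pi) powr (1/2) * (\<nu> / pi) powr (3/4) = (\<nu> / pi) powr (5/4)"
      by (simp add: powr_add[symmetric])
    moreover have "((\<nu> / pi) powr (5/4))\<^sup>2 = (\<nu> / pi) powr (5/2)"
      by (simp add: power2_eq_square powr_add[symmetric])
    moreover have "(sqrt 2 ^ n)\<^sup>2 = (2::real) ^ n"
      by (simp flip: power_mult power_mult_distrib add: power2_eq_square)
    ultimately show ?thesis by (simp add: G_coeff_def power_divide)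
  qed
  moreover have "(\<nu> / pi) powr (5/2) * ((pi / \<nu>)\<^sup>2 * sqrt (pi / \<nu>)) = 1"
  proof -
    have "(pi / \<nu>)\<^sup>2 * sqrt (pi / \<nu>) = (pi / \<nu>) powr 2 * (pi / \<nu>) powr (1/2)"
      using \<nu> by (simp add: powr_half_sqrt powr_numeral)
    also have "\<dots> = (pi / \<nu>) powr (5/2)" by (simp add: powr_add[symmetric])
    finally show ?thesis using \<nu> by (simp add: powr_mult[symmetric])
  qed
  moreover have "(2 / \<nu>) ^ n * fact n * (\<nu> ^ n / fact n) / 2 ^ n = 1"
    using \<nu> by (simp add: power_divide)
  ultimately show ?thesis
    by (simp add: e_norm2_def hermite_norm2_def field_simps)
qed

lemma G_transform_in_A_space:
  assumes \<nu>: "\<nu> > 0" and f: "f \<in> l2_space (gauss_measure \<nu>)"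
  shows "G_transform \<nu> f \<in> A_space \<nu>"
  unfolding G_transform_power_series(2)[OF \<nu> f]
proof (rule A_space_power_seriesI[OF G_transform_power_series(1)[OF \<nu> f] \<nu>])
  let ?M = "gauss_measure \<nu> :: real measure" and ?h = "hermite_fun \<nu>"
  \<comment> \<open>By \<open>G_coeff_norm\<close>,
    \<open>(G_coeff \<nu> n)^2 * e_norm2 \<nu> n\<close> is the reciprocal of the squared Hermite
    norm, so the Parseval series is the Bessel series of \<open>f\<close>.\<close>
  have summand: "(norm (of_real (G_coeff \<nu> n) * l2_inner ?M f (?h n)))\<^sup>2 * e_norm2 \<nu> n = 
     (norm (l2_inner ?M f (?h n)))\<^sup>2 / (l2_norm ?M (?h n))\<^sup>2" for n
    using G_coeff_norm[OF \<nu>, of n] hermite_norm2_pos[OF \<nu>, of n] unfolding l2_norm_hermite_fun[OF \<nu>]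
    by (simp add: norm_mult power_mult_distrib field_simps)
  show "summable (\<lambda>n. (norm (of_real (G_coeff \<nu> n) * l2_inner ?M f (?h n)))\<^sup>2 * e_norm2 \<nu> n)"
    unfolding summand
  proof (rule summableI_nonneg_bounded)
    show "(\<Sum>n<k. (norm (l2_inner ?M f (?h n)))\<^sup>2 / (l2_norm ?M (?h n))\<^sup>2) \<le> (l2_norm ?M f)\<^sup>2" for k
    proof (rule bessel_inequality[OF f])
      show "l2_norm ?M (?h n) > 0" for n
        using l2_norm_hermite_fun[OF \<nu>, of n] hermite_norm2_pos[OF \<nu>, of n] l2_norm_nonneg[of ?M "?h n"]
        by (cases "l2_norm ?M (?h n) = 0") auto
    qed (auto simp: l2_inner_hermite_fun[OF \<nu>] hermite_fun_l2_space[OF \<nu>])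
  qed simp
qed

lemma A_space_in_range_G_transform:
  assumes \<nu>: "\<nu> > 0" and F: "F \<in> A_space \<nu>"
  shows "F \<in> G_transform \<nu> ` l2_space (gauss_measure \<nu>)"
proof -
  let ?M = "gauss_measure \<nu> :: real measure" and ?h = "hermite_fun \<nu>"
  obtain g a where g: "\<And>u. (\<lambda>n. a n * u ^ n) sums g u" and Fg: "F = (\<lambda>p. g (fst p + \<i> * snd p))"
    by (rule A_space_power_series[OF F]) blast
  have summ: "summable (\<lambda>n. (norm (a n))\<^sup>2 * e_norm2 \<nu> n)"
    using F Fg power_series_l2_space_iff[OF g \<nu>] by (auto simp: A_space_iff)
  have G: "G_coeff \<nu> n > 0" for n using \<nu> by (simp add: G_coeff_def)
  \<comment> \<open>Forced by the coefficients: a limit of the sums of \<open>d n * ?h n\<close> has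
    inner product \<open>d n * hermite_norm2 \<nu> n\<close> with \<open>?h n\<close>, and
    \<open>G_coeff \<nu> n\<close> times this has to be \<open>a n\<close>.\<close>
  define d where "d n = a n / of_real (G_coeff \<nu> n * hermite_norm2 \<nu> n)" for n
  have h: "?h n \<in> l2_space ?M" for n by (rule hermite_fun_l2_space[OF \<nu>])
  \<comment> \<open>The candidate expansion has the same squared terms as the Parseval series of
    \<open>F\<close>, which makes its partial sums Cauchy.\<close>
  have dn: "(norm (d n))\<^sup>2 * hermite_norm2 \<nu> n = (norm (a n))\<^sup>2 * e_norm2 \<nu> n" for n
  proof -
    have "norm (a n) = norm (d n) * (G_coeff \<nu> n * hermite_norm2 \<nu> n)"
      using G[of n] hermite_norm2_pos[OF \<nu>, of n] by (simp add: d_def norm_divide norm_mult)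
    then have "(norm (a n))\<^sup>2 * e_norm2 \<nu> n = 
        ((norm (d n))\<^sup>2 * hermite_norm2 \<nu> n) * ((G_coeff \<nu> n)\<^sup>2 * e_norm2 \<nu> n * hermite_norm2 \<nu> n)"
      by (simp add: power2_eq_square)
    then show ?thesis unfolding G_coeff_norm[OF \<nu>] by simp
  qed
  define u where "u k x = (\<Sum>n<k. d n * ?h n x)" for k x
  have u: "u k \<in> l2_space ?M" for k unfolding u_def[abs_def] by (rule l2_space_sum[OF h])
  have orth: "l2_inner ?M (?h m) (?h n) = 0" if "m \<noteq> n" for m n
    using that by (simp add: l2_inner_hermite_fun[OF \<nu>])
  have dist: "(l2_dist ?M (u m) (u n))\<^sup>2 = (\<Sum>i=n..<m. (norm (a i))\<^sup>2 * e_norm2 \<nu> i)" if "n \<le> m" for m n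
  proof -
    have diff: "u m - u n = (\<lambda>x. \<Sum>i=n..<m. d i * ?h i x)"
      using that by (auto simp: fun_eq_iff u_def sum_diff_nat_ivl[of 0] lessThan_atLeast0)
    show ?thesis
      unfolding l2_dist_def diff dn[symmetric] l2_norm_hermite_fun[OF \<nu>, symmetric]
      by (rule l2_norm_sum_orthogonal[OF h orth finite_atLeastLessThan])
  qed
  have cauchy: "\<exists>N. \<forall>m\<ge>N. \<forall>n\<ge>N. l2_dist ?M (u m) (u n) < \<epsilon>" if \<epsilon>: "\<epsilon> > 0" for \<epsilon>
  proof -
    obtain N where N: "\<And>m n. m \<ge> N \<Longrightarrow> norm (\<Sum>i=m..<n. (norm (a i))\<^sup>2 * e_norm2 \<nu> i) < \<epsilon>\<^sup>2"
      using summ[unfolded summable_Cauchy, rule_format, OF zero_less_power[OF \<epsilon>, of 2]] by blast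
    have 1: "l2_dist ?M (u m) (u n) < \<epsilon>" if "n \<ge> N" "n \<le> m" for m n
    proof -
      have "(l2_dist ?M (u m) (u n))\<^sup>2 < \<epsilon>\<^sup>2" using N[OF that(1), of m] dist[OF that(2)] by (simp only: real_norm_def)
      then show ?thesis by (rule power2_less_imp_less) (use \<epsilon> in simp)
    qed
    have "l2_dist ?M (u m) (u n) < \<epsilon>" if "m \<ge> N" "n \<ge> N" for m n
    proof (cases "n \<le> m")
      case True
      with 1 that show ?thesis by blast
    next
      case False
      then have "l2_dist ?M (u n) (u m) < \<epsilon>" using 1 that by simp
      then show ?thesis by (subst l2_dist_commute)
    qed
    then show ?thesis by blast
  qed
  obtain f where f: "f \<in> l2_space ?M" and lim: "(\<lambda>k. l2_dist ?M f (u k)) \<longlonglongrightarrow> 0"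
    by (rule riesz_fischer[OF finite_measure_gauss_real[OF \<nu>] u cauchy])
  \<comment> \<open>The inner product of \<open>u k\<close> with \<open>?h n\<close> no longer
    changes once \<open>k > n\<close>; Cauchy-Schwarz carries its value over to the limit.\<close>
  have coeff: "l2_inner ?M f (?h n) = d n * of_real (hermite_norm2 \<nu> n)" for n
  proof -
    have "l2_inner ?M (u k) (?h n) = d n * of_real (hermite_norm2 \<nu> n)" if "k > n" for k
    proof -
      have "l2_inner ?M (u k) (?h n) = (\<Sum>i<k. d i * l2_inner ?M (?h i) (?h n))"
        unfolding u_def[abs_def] by (rule l2_inner_sum_left[OF h h])
      also have "\<dots> = (\<Sum>i<k. if i = n then d n * of_real (hermite_norm2 \<nu> n) else 0)"
        by (intro sum.cong) (auto simp: l2_inner_hermite_fun[OF \<nu>])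
      finally show ?thesis using that by simp
    qed
    then have "norm (l2_inner ?M f (?h n) - d n * of_real (hermite_norm2 \<nu> n)) 
        \<le> l2_dist ?M f (u k) * l2_norm ?M (?h n)" if "k > n" for k
      using norm_l2_inner_le[OF l2_space_diff[OF f u] h, of k n] that
      by (simp only: l2_inner_diff_left[OF f u h] l2_dist_def)
    then have "eventually (\<lambda>k. norm (l2_inner ?M f (?h n) - d n * of_real (hermite_norm2 \<nu> n)) 
        \<le> l2_dist ?M f (u k) * l2_norm ?M (?h n)) sequentially"
      by (intro eventually_mono[OF eventually_gt_at_top[of n]])
    then have "norm (l2_inner ?M f (?h n) - d n * of_real (hermite_norm2 \<nu> n)) \<le> 0 * l2_norm ?M (?h n)"
      by (rule tendsto_lowerbound[OF tendsto_mult_right[OF lim]]) simp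
    then show ?thesis by simp
  qed
  define g' where "g' = (\<lambda>u. of_real ((\<nu> / pi) powr (1/2)) * bargmann \<nu> f (u / of_real (sqrt 2)))"
  have "(\<lambda>n. a n * v ^ n) sums g' v" for v
  proof -
    have "of_real (G_coeff \<nu> n) * l2_inner ?M f (?h n) = a n" for n
      unfolding coeff d_def using G[of n] hermite_norm2_pos[OF \<nu>, of n] by simp
    then show ?thesis 
      using G_transform_power_series(1)[OF \<nu> f, of v] unfolding g'_def by (simp only:)
  qed
  \<comment> \<open>Both are sums of the same everywhere convergent series, so they agree at every
    point.\<close>
  then have "g' v = g v" for v using g by (rule sums_unique2)
  then have "g' = g" ..
  moreover have "G_transform \<nu> f = (\<lambda>p. g' (fst p + \<i> * snd p))"
    unfolding g'_def by (rule G_transform_power_series(2)[OF \<nu> f])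
  ultimately have "F = G_transform \<nu> f" using Fg by simp
  then show ?thesis using f by blast
qed

theorem theorem2p2:
  fixes \<nu> :: real
  assumes "\<nu> > 0"
  shows "closed_subspace (gauss_measure \<nu>) (fock_space \<nu>) (A_space \<nu>) \<and>
    orthogonal_basis (gauss_measure \<nu>) (A_space \<nu>) e_fun \<and>
    A_space \<nu> = G_transform \<nu> ` l2_space (gauss_measure \<nu>)"
  using closed_subspace_A_space orthogonal_basis_e_fun G_transform_in_A_space 
    A_space_in_range_G_transform assms by blast

end
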